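(* Let $1\leqslant p<n$, let $\underline F_i\leqslant\overline F_i$ ($i=1,\ldots,n$) and $F_Z$ be distribution functions, and let $F_i\in\mathcal F_{(\underline F_i,\overline F_i)}$ for $i=1,\ldots,n$ be arbitrary. With $G_i,\underline G_i,\overline G_i$, $H,\underline H,\overline H$, the vectors of generating functions $\pmb\varphi,\underline{\pmb\varphi},\overline{\pmb\varphi}$, the auxiliary functions $\varphi_i^\dag,\underline\varphi_i^\dag,\overline\varphi_i^\dag$ and the copulas $C^{\mathrm{MM}}_{\pmb\varphi}$ as defined in the context, the following hold: (i) $\underline{\pmb\varphi}\leqslant\overline{\pmb\varphi}$. (ii) $G_i=F_iF_Z$, $\underline G_i=\underline F_iF_Z$, $\overline G_i=\overline F_iF_Z$ for $i=1,\ldots,p$, and $\widehat G_j=\widehat F_j\widehat F_Z$, $\widehat{\underline G}_j=\widehat{\underline F}_j\widehat F_Z$, $\widehat{\overline G}_j=\widehat{\overline F}_j\widehat F_Z$ for $j=p+1,\ldots,n$. (iii) $\underline G_i\leqslant G_i\leqslant\overline G_i$ for $i=1,\ldots,p$, and $\underline G_j\leqslant G_j\leqslant\overline G_j$ for $j=p+1,\ldots,n$. (iv) For $i=1,\ldots,p$: $\underline\varphi_i(\underline G_i)=\underline F_i$ if $\underline G_i>0$, and $\overline\varphi_i(\overline G_i)=\overline F_i$ if $\overline G_i>0$. For $j=p+1,\ldots,n$: $\underline\chi_j(\underline G_j)=\underline F_j$ if $\underline G_j<1$, and $\overline\chi_j(\overline G_j)=\overline F_j$ if $\overline G_j<1$.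 (v) $\varphi_i^\dag(G_i)=\overline\varphi_j^\dag(\overline G_j)=\underline\varphi_k^\dag(\underline G_k)=F_Z$ for all $i,j,k=1,\ldots,n$, at every point where the distribution function inside each of these is positive (if its index is $\leqslant p$), respectively less than $1$ (if its index is $>p$). (vi) $H(x_1,\ldots,x_n)=C^{\mathrm{MM}}_{\pmb\varphi}(G_1(x_1),\ldots,G_n(x_n))$ for all $x_1,\ldots,x_n$. (vii) For all $x_1,\ldots,x_n$, $$C^{\mathrm{MM}}_{\underline{\pmb\varphi}}(\underline G_1(x_1),\ldots,\underline G_n(x_n))\leqslant C^{\mathrm{MM}}_{\pmb\varphi}(G_1(x_1),\ldots,G_n(x_n))\leqslant C^{\mathrm{MM}}_{\overline{\pmb\varphi}}(\overline G_1(x_1),\ldots,\overline G_n(x_n)).$$ (viii) For all $x_1,\ldots,x_n$, $$\underline H(x_1,\ldots,x_n)=C^{\mathrm{MM}}_{\underline{\pmb\varphi}}(\underline G_1(x_1),\ldots,\underline G_n(x_n)),\qquad\overline H(x_1,\ldots,x_n)=C^{\mathrm{MM}}_{\overline{\pmb\varphi}}(\overline G_1(x_1),\ldots,\overline G_n(x_n)).$$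
   Context: "Increasing"/"decreasing" are meant in the weak sense; inequalities between functions are pointwise and between vectors of functions componentwise. Probabilities are finitely additive. A distribution function is an increasing map $F:\overline{\mathbb R}=\mathbb R\cup\{\pm\infty\}\to[0,1]$ with $F(-\infty)=0$, $F(+\infty)=1$ (no one-sided continuity is assumed). Write $\widehat F=1-F$ (also $\widehat{\underline F}=1-\underline F$, $\widehat{\overline F}=1-\overline F$). For distribution functions $\underline F\leqslant\overline F$, $\mathcal F_{(\underline F,\overline F)}$ is the set of all distribution functions $F$ with $\underline F\leqslant F\leqslant\overline F$. Put $T=\{1,\ldots,p\}$, $S=\{p+1,\ldots,n\}$. Shock model: let $X_1,\ldots,X_n,Z$ be independent with distribution functions $F_1,\ldots,F_n,F_Z$ (independence: joint probabilities of events that the variables lie in given intervals factorize). Put $U_i=\max\{X_i,Z\}$ for $i\in T$ and $U_j=\min\{X_j,Z\}$ for $j\in S$; $G_i$ is the distribution function of $U_i$, $i=1,\ldots,n$, and $H(x_1,\ldots,x_n)=P(U_1\leqslant x_1,\ldots,U_n\leqslant x_n)$. $\underline G_i,\overline G_i$ are the pointwise infimum and supremum of $G_i$ as $F_i$ ranges over $\mathcal F_{(\underline F_i,\overline F_i)}$; $\underline H,\overline H$ are the pointwise minimum and maximum of $H$ as all $F_i$ range over $\mathcal F_{(\underline F_i,\overline F_i)}$ ($F_Z$ is fixed). Generating functions. For a vector $\pmb\varphi=(\varphi_1,\ldots,\varphi_p,\chi_{p+1},\ldots,\chi_n)$ of functions $[0,1]\to[0,1]$ define $$\varphi_i^\dag(u)=\frac{u}{\varphi_i(u)}\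 (i\in T,\ u>0),\qquad \varphi_j^\dag(u)=\frac{u-\chi_j(u)}{1-\chi_j(u)}\ (j\in S,\ u<1),$$ with $\varphi_i^\dag(0)=0$ for $i\in T$ and $\varphi_j^\dag(1)=1$ for $j\in S$. Conditions (F1)--(F3): (F1) each component takes $0$ to $0$ and $1$ to $1$; (F2) each component is increasing; (F3) each $\varphi_i^\dag$, $i\in T$, is increasing on $(0,1]$ with values in $[0,1]$, and each $\varphi_j^\dag$, $j\in S$, is increasing on $[0,1)$ with values in $[0,1]$. The functions $\underline\varphi_i^\dag$, $\overline\varphi_i^\dag$ ($i=1,\ldots,n$) are defined by the same formulas from the components of $\underline{\pmb\varphi}$, $\overline{\pmb\varphi}$ below. Construction of $\pmb\varphi$ from $(F_1,\ldots,F_n,F_Z)$. Write $F(x\pm)$ for one-sided limits, with $F(-\infty-)=F(-\infty)$, $F(+\infty+)=F(+\infty)$. All $\varphi_i,\chi_j$ take $0\mapsto0$, $1\mapsto1$. For $i\in T$ and $u\in(0,1)$ choose any $x_0$ with $G_i(x_0-)\leqslant u\leqslant G_i(x_0+)$, put $u_-=G_i(x_0-)$, $u_l=F_i(x_0-)F_Z(x_0)$, $u_u=F_i(x_0+)F_Z(x_0)$, $u_+=G_i(x_0+)$; then $\varphi_i(u)=F_i(x_0-)$ if $u_-\leqslant u\leqslant u_l$, $\varphi_i(u)=u/F_Z(x_0)$ if $u_l\leqslant u\leqslant u_u$, $\varphi_i(u)=F_i(x_0+)$ if $u_u\leqslant u\leqslant u_+$. For $j\in S$ and $v\in(0,1)$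 choose any $y_0$ with $G_j(y_0-)\leqslant v\leqslant G_j(y_0+)$, put $v_-=G_j(y_0-)$, $v_l=F_j(y_0-)+F_Z(y_0)-F_j(y_0-)F_Z(y_0)$, $v_u=F_j(y_0+)+F_Z(y_0)-F_j(y_0+)F_Z(y_0)$, $v_+=G_j(y_0+)$; then $\chi_j(v)=F_j(y_0-)$ if $v_-\leqslant v\leqslant v_l$, $\chi_j(v)=\frac{v-F_Z(y_0)}{1-F_Z(y_0)}$ if $v_l\leqslant v\leqslant v_u$, $\chi_j(v)=F_j(y_0+)$ if $v_u\leqslant v\leqslant v_+$. It is known that these functions satisfy (F1)--(F3), that $\varphi_i(G_i)=F_i$ where $G_i>0$ ($i\in T$) and $\chi_j(G_j)=F_j$ where $G_j<1$ ($j\in S$), and that the construction is monotone: $F_i'\leqslant F_i$ implies $\varphi_i'\leqslant\varphi_i$, and $F_j'\leqslant F_j$ implies $\chi_j'\leqslant\chi_j$. Bounding generators: $\underline\varphi_i$ (resp. $\overline\varphi_i$), $i\in T$, is the minimal (resp. maximal) function satisfying (F1)--(F3) and $\underline\varphi_i(\underline G_i)=\underline F_i$ where $\underline G_i>0$ (resp. $\overline\varphi_i(\overline G_i)=\overline F_i$ where $\overline G_i>0$); $\underline\chi_j$ (resp. $\overline\chi_j$), $j\in S$, is the minimal (resp. maximal) function satisfying (F1)--(F3) and $\underline\chi_j(\underline G_j)=\underline F_j$ where $\underline G_j<1$ (resp. $\overline\chi_j(\overline G_j)=\overline F_j$ where $\overline G_j<1$). Put $\underline{\pmb\varphi}=(\underline\varphi_1,\ldots,\underline\varphi_p,\underline\chi_{p+1},\ldots,\underline\chi_n)$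 and $\overline{\pmb\varphi}=(\overline\varphi_1,\ldots,\overline\varphi_p,\overline\chi_{p+1},\ldots,\overline\chi_n)$. Multivariate maxmin (MM) copula: for $\pmb\varphi$ satisfying (F1)--(F3), $$C^{\mathrm{MM}}_{\pmb\varphi}(\mathbf u)=\Big(\prod_{i\in T}\varphi_i(u_i)\Big)\sum_{K\subseteq S}\ \prod_{j\in S\setminus K}\chi_j(u_j)\,\max\Big\{0,\min_{i\in T\cup K}\varphi_i^\dag(u_i)-\max_{j\in S\setminus K}\varphi_j^\dag(u_j)\Big\},$$ where the maximum over the empty set is $0$. *)

theory Defs
  imports "HOL-Analysis.Analysis"
begin

section \<open>Distribution functions on the extended real line\<close>

definition dist_fun :: "(ereal \<Rightarrow> real) \<Rightarrow> bool" where
  "dist_fun F \<longleftrightarrow> F \<in> UNIV \<rightarrow> {0..1} \<and> mono F \<and> F (-\<infinity>) = 0 \<and> F \<infinity> = 1"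

definition dist_box :: "(ereal \<Rightarrow> real) \<Rightarrow> (ereal \<Rightarrow> real) \<Rightarrow> (ereal \<Rightarrow> real) set" where
  "dist_box Fl Fu = {F. dist_fun F \<and> Fl \<le> F \<and> F \<le> Fu}"

text \<open>One-sided limits. The filters \<open>at_left (-\<infinity>)\<close> and \<open>at_right \<infinity>\<close> are trivial, so the
  conventional values at the two end points have to be given separately.\<close>

definition left_lim :: "(ereal \<Rightarrow> real) \<Rightarrow> ereal \<Rightarrow> real" where
  "left_lim F x = (if x = -\<infinity> then F (-\<infinity>) else Lim (at_left x) F)"

definition right_lim :: "(ereal \<Rightarrow> real) \<Rightarrow> ereal \<Rightarrow> real" where
  "right_lim F x = (if x = \<infinity> then F \<infinity> else Lim (at_right x) F)"


section \<open>The shock model over a finitely additive probability\<close>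

definition fin_add_prob :: "'a set \<Rightarrow> 'a set set \<Rightarrow> ('a set \<Rightarrow> real) \<Rightarrow> bool" where
  "fin_add_prob \<Omega> M P \<longleftrightarrow>
     algebra \<Omega> M \<and> (\<forall>A\<in>M. 0 \<le> P A) \<and> additive M P \<and> P \<Omega> = 1"

text \<open>In the complete linear order \<^typ>\<open>ereal\<close> the order-convex sets are exactly the (open, closed,
  half-open, degenerate, bounded or unbounded) intervals.\<close>

definition ereal_interval :: "ereal set \<Rightarrow> bool" where
  "ereal_interval I \<longleftrightarrow> (\<forall>a\<in>I. \<forall>b\<in>I. {a..b} \<subseteq> I)"

definition rand_var :: "'a set \<Rightarrow> 'a set set \<Rightarrow> ('a \<Rightarrow> ereal) \<Rightarrow> bool" where
  "rand_var \<Omega> M Y \<longleftrightarrow> (\<forall>I. ereal_interval I \<longrightarrow> {\<omega>\<in>\<Omega>. Y \<omega> \<in> I} \<in> M)"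

definition cdf_of :: "'a set \<Rightarrow> ('a set \<Rightarrow> real) \<Rightarrow> ('a \<Rightarrow> ereal) \<Rightarrow> ereal \<Rightarrow> real" where
  "cdf_of \<Omega> P Y x = P {\<omega>\<in>\<Omega>. Y \<omega> \<le> x}"

text \<open>Independence of \<open>X 1, \<dots>, X n, Z\<close>. Subfamilies are covered by taking some of the intervals
  to be \<^term>\<open>UNIV\<close>.\<close>

definition indep_on_intervals ::
  "nat \<Rightarrow> 'a set \<Rightarrow> ('a set \<Rightarrow> real) \<Rightarrow> (nat \<Rightarrow> 'a \<Rightarrow> ereal) \<Rightarrow> ('a \<Rightarrow> ereal) \<Rightarrow> bool" where
  "indep_on_intervals n \<Omega> P X Z \<longleftrightarrow>
     (\<forall>I J. (\<forall>i\<in>{1..n}. ereal_interval (I i)) \<and> ereal_interval J \<longrightarrow>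
        P {\<omega>\<in>\<Omega>. (\<forall>i\<in>{1..n}. X i \<omega> \<in> I i) \<and> Z \<omega> \<in> J} =
        (\<Prod>i\<in>{1..n}. P {\<omega>\<in>\<Omega>. X i \<omega> \<in> I i}) * P {\<omega>\<in>\<Omega>. Z \<omega> \<in> J})"

definition shock_model ::
  "nat \<Rightarrow> 'a set \<Rightarrow> 'a set set \<Rightarrow> ('a set \<Rightarrow> real) \<Rightarrow> (nat \<Rightarrow> 'a \<Rightarrow> ereal) \<Rightarrow> ('a \<Rightarrow> ereal) \<Rightarrow>
   (nat \<Rightarrow> ereal \<Rightarrow> real) \<Rightarrow> (ereal \<Rightarrow> real) \<Rightarrow> bool" where
  "shock_model n \<Omega> M P X Z F FZ \<longleftrightarrow>
     fin_add_prob \<Omega> M P \<and>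
     (\<forall>i\<in>{1..n}. rand_var \<Omega> M (X i)) \<and> rand_var \<Omega> M Z \<and>
     indep_on_intervals n \<Omega> P X Z \<and>
     (\<forall>i\<in>{1..n}. cdf_of \<Omega> P (X i) = F i) \<and> cdf_of \<Omega> P Z = FZ"

definition shock_U :: "nat \<Rightarrow> (nat \<Rightarrow> 'a \<Rightarrow> ereal) \<Rightarrow> ('a \<Rightarrow> ereal) \<Rightarrow> nat \<Rightarrow> 'a \<Rightarrow> ereal" where
  "shock_U p X Z i \<omega> = (if i \<le> p then max (X i \<omega>) (Z \<omega>) else min (X i \<omega>) (Z \<omega>))"

definition shock_G ::
  "nat \<Rightarrow> 'a set \<Rightarrow> ('a set \<Rightarrow> real) \<Rightarrow> (nat \<Rightarrow> 'a \<Rightarrow> ereal) \<Rightarrow> ('a \<Rightarrow> ereal) \<Rightarrow>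
   nat \<Rightarrow> ereal \<Rightarrow> real" where
  "shock_G p \<Omega> P X Z i = cdf_of \<Omega> P (shock_U p X Z i)"

definition shock_H ::
  "nat \<Rightarrow> nat \<Rightarrow> 'a set \<Rightarrow> ('a set \<Rightarrow> real) \<Rightarrow> (nat \<Rightarrow> 'a \<Rightarrow> ereal) \<Rightarrow> ('a \<Rightarrow> ereal) \<Rightarrow>
   (nat \<Rightarrow> ereal) \<Rightarrow> real" where
  "shock_H n p \<Omega> P X Z x = P {\<omega>\<in>\<Omega>. \<forall>i\<in>{1..n}. shock_U p X Z i \<omega> \<le> x i}"

text \<open>The values taken by \<open>G\<^sub>i x\<close> and \<open>H x\<close> when the distribution functions of \<open>X 1, \<dots>, X n\<close> range over
  the given boxes. HOL cannot quantify over sample space types inside a definition; the type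
  \<^typ>\<open>nat \<Rightarrow> ereal\<close> loses nothing, because every shock model can be transported to it along
  \<open>\<omega> \<mapsto> (Z \<omega>, X 1 \<omega>, \<dots>, X n \<omega>)\<close>. Letting all \<open>F k\<close> vary in \<open>G_values\<close> is harmless, since the
  distribution of \<open>U\<^sub>i\<close> depends on those of \<open>X i\<close> and \<open>Z\<close> only.\<close>

definition G_values ::
  "nat \<Rightarrow> nat \<Rightarrow> (nat \<Rightarrow> ereal \<Rightarrow> real) \<Rightarrow> (nat \<Rightarrow> ereal \<Rightarrow> real) \<Rightarrow> (ereal \<Rightarrow> real) \<Rightarrow>
   nat \<Rightarrow> ereal \<Rightarrow> real set" where
  "G_values n p Fl Fu FZ i x =
     {shock_G p \<Omega> P X Z i x | (\<Omega> :: (nat \<Rightarrow> ereal) set) M P X Z F.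
        (\<forall>k\<in>{1..n}. F k \<in> dist_box (Fl k) (Fu k)) \<and> shock_model n \<Omega> M P X Z F FZ}"

definition H_values ::
  "nat \<Rightarrow> nat \<Rightarrow> (nat \<Rightarrow> ereal \<Rightarrow> real) \<Rightarrow> (nat \<Rightarrow> ereal \<Rightarrow> real) \<Rightarrow> (ereal \<Rightarrow> real) \<Rightarrow>
   (nat \<Rightarrow> ereal) \<Rightarrow> real set" where
  "H_values n p Fl Fu FZ x =
     {shock_H n p \<Omega> P X Z x | (\<Omega> :: (nat \<Rightarrow> ereal) set) M P X Z F.
        (\<forall>k\<in>{1..n}. F k \<in> dist_box (Fl k) (Fu k)) \<and> shock_model n \<Omega> M P X Z F FZ}"

definition lower_G ::
  "nat \<Rightarrow> nat \<Rightarrow> (nat \<Rightarrow> ereal \<Rightarrow> real) \<Rightarrow> (nat \<Rightarrow> ereal \<Rightarrow> real) \<Rightarrow> (ereal \<Rightarrow> real) \<Rightarrow>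
   nat \<Rightarrow> ereal \<Rightarrow> real" where
  "lower_G n p Fl Fu FZ i x = Inf (G_values n p Fl Fu FZ i x)"

definition upper_G ::
  "nat \<Rightarrow> nat \<Rightarrow> (nat \<Rightarrow> ereal \<Rightarrow> real) \<Rightarrow> (nat \<Rightarrow> ereal \<Rightarrow> real) \<Rightarrow> (ereal \<Rightarrow> real) \<Rightarrow>
   nat \<Rightarrow> ereal \<Rightarrow> real" where
  "upper_G n p Fl Fu FZ i x = Sup (G_values n p Fl Fu FZ i x)"

text \<open>These are a minimum and a maximum once they are known to belong to \<^const>\<open>H_values\<close>.\<close>

definition lower_H ::
  "nat \<Rightarrow> nat \<Rightarrow> (nat \<Rightarrow> ereal \<Rightarrow> real) \<Rightarrow> (nat \<Rightarrow> ereal \<Rightarrow> real) \<Rightarrow> (ereal \<Rightarrow> real) \<Rightarrow>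
   (nat \<Rightarrow> ereal) \<Rightarrow> real" where
  "lower_H n p Fl Fu FZ x = Inf (H_values n p Fl Fu FZ x)"

definition upper_H ::
  "nat \<Rightarrow> nat \<Rightarrow> (nat \<Rightarrow> ereal \<Rightarrow> real) \<Rightarrow> (nat \<Rightarrow> ereal \<Rightarrow> real) \<Rightarrow> (ereal \<Rightarrow> real) \<Rightarrow>
   (nat \<Rightarrow> ereal) \<Rightarrow> real" where
  "upper_H n p Fl Fu FZ x = Sup (H_values n p Fl Fu FZ x)"


section \<open>Generating functions\<close>

text \<open>A vector of generating functions is a family indexed by \<open>{1..n}\<close>; the components with index
  \<open>\<le> p\<close> are the \<open>\<phi>\<^sub>i\<close>, those with index \<open>> p\<close> the \<open>\<chi>\<^sub>j\<close>. Only arguments in \<open>{0..1}\<close> matter.\<close>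

definition dagger :: "nat \<Rightarrow> nat \<Rightarrow> (real \<Rightarrow> real) \<Rightarrow> real \<Rightarrow> real" where
  "dagger p i f u =
     (if i \<le> p then (if u = 0 then 0 else u / f u)
      else (if u = 1 then 1 else (u - f u) / (1 - f u)))"

text \<open>The conditions (F1)--(F3) on the \<open>i\<close>-th component. As \<open>x / 0 = 0\<close> in HOL, it has to be
  required explicitly that the denominators in \<^const>\<open>dagger\<close> do not vanish.\<close>

definition generating :: "nat \<Rightarrow> nat \<Rightarrow> (real \<Rightarrow> real) \<Rightarrow> bool" where
  "generating p i f \<longleftrightarrow>
     f \<in> {0..1} \<rightarrow> {0..1} \<and> f 0 = 0 \<and> f 1 = 1 \<and> mono_on {0..1} f \<and>
     (if i \<le> p
      then (\<forall>u\<in>{0<..1}. f u \<noteq> 0) \<and>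
           mono_on {0<..1} (dagger p i f) \<and> dagger p i f \<in> {0<..1} \<rightarrow> {0..1}
      else (\<forall>u\<in>{0..<1}. f u \<noteq> 1) \<and>
           mono_on {0..<1} (dagger p i f) \<and> dagger p i f \<in> {0..<1} \<rightarrow> {0..1})"

text \<open>\<open>f\<close> arises from \<open>F\<close>, \<open>FZ\<close> and \<open>G\<close> by the construction with some choice of an admissible
  point \<open>x0\<close> for every \<open>u\<close>.\<close>

definition constructed_max ::
  "(ereal \<Rightarrow> real) \<Rightarrow> (ereal \<Rightarrow> real) \<Rightarrow> (ereal \<Rightarrow> real) \<Rightarrow> (real \<Rightarrow> real) \<Rightarrow> bool" where
  "constructed_max F FZ G f \<longleftrightarrow>
     f 0 = 0 \<and> f 1 = 1 \<and>
     (\<forall>u\<in>{0<..<1}. \<exists>x0.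
        left_lim G x0 \<le> u \<and> u \<le> right_lim G x0 \<and>
        (let ul = left_lim F x0 * FZ x0; uu = right_lim F x0 * FZ x0 in
         (left_lim G x0 \<le> u \<and> u \<le> ul \<longrightarrow> f u = left_lim F x0) \<and>
         (ul \<le> u \<and> u \<le> uu \<longrightarrow> f u = u / FZ x0) \<and>
         (uu \<le> u \<and> u \<le> right_lim G x0 \<longrightarrow> f u = right_lim F x0)))"

definition constructed_min ::
  "(ereal \<Rightarrow> real) \<Rightarrow> (ereal \<Rightarrow> real) \<Rightarrow> (ereal \<Rightarrow> real) \<Rightarrow> (real \<Rightarrow> real) \<Rightarrow> bool" where
  "constructed_min F FZ G f \<longleftrightarrow>
     f 0 = 0 \<and> f 1 = 1 \<and>
     (\<forall>v\<in>{0<..<1}. \<exists>y0.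
        left_lim G y0 \<le> v \<and> v \<le> right_lim G y0 \<and>
        (let vl = left_lim F y0 + FZ y0 - left_lim F y0 * FZ y0;
             vu = right_lim F y0 + FZ y0 - right_lim F y0 * FZ y0 in
         (left_lim G y0 \<le> v \<and> v \<le> vl \<longrightarrow> f v = left_lim F y0) \<and>
         (vl \<le> v \<and> v \<le> vu \<longrightarrow> f v = (v - FZ y0) / (1 - FZ y0)) \<and>
         (vu \<le> v \<and> v \<le> right_lim G y0 \<longrightarrow> f v = right_lim F y0)))"

definition constructed ::
  "nat \<Rightarrow> nat \<Rightarrow> (ereal \<Rightarrow> real) \<Rightarrow> (ereal \<Rightarrow> real) \<Rightarrow> (ereal \<Rightarrow> real) \<Rightarrow> (real \<Rightarrow> real) \<Rightarrow> bool" where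
  "constructed p i F FZ G f \<longleftrightarrow>
     (if i \<le> p then constructed_max F FZ G f else constructed_min F FZ G f)"

definition compatible_generators ::
  "nat \<Rightarrow> nat \<Rightarrow> (ereal \<Rightarrow> real) \<Rightarrow> (ereal \<Rightarrow> real) \<Rightarrow> (real \<Rightarrow> real) set" where
  "compatible_generators p i G F =
     {f. generating p i f \<and> (\<forall>x. (if i \<le> p then G x > 0 else G x < 1) \<longrightarrow> f (G x) = F x)}"

text \<open>Least and greatest elements with respect to the pointwise order on \<open>{0..1}\<close>; they are unique
  on \<open>{0..1}\<close>.\<close>

definition least_generator :: "(real \<Rightarrow> real) set \<Rightarrow> real \<Rightarrow> real" where
  "least_generator A = (SOME f. f \<in> A \<and> (\<forall>g\<in>A. \<forall>u\<in>{0..1}. f u \<le> g u))"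

definition greatest_generator :: "(real \<Rightarrow> real) set \<Rightarrow> real \<Rightarrow> real" where
  "greatest_generator A = (SOME f. f \<in> A \<and> (\<forall>g\<in>A. \<forall>u\<in>{0..1}. g u \<le> f u))"


section \<open>The multivariate maxmin copula\<close>

definition max_or_0 :: "real set \<Rightarrow> real" where
  "max_or_0 A = (if A = {} then 0 else Max A)"

definition C_MM :: "nat \<Rightarrow> nat \<Rightarrow> (nat \<Rightarrow> real \<Rightarrow> real) \<Rightarrow> (nat \<Rightarrow> real) \<Rightarrow> real" where
  "C_MM n p \<phi> u =
     (\<Prod>i\<in>{1..p}. \<phi> i (u i)) *
     (\<Sum>K\<in>Pow {p+1..n}.
        (\<Prod>j\<in>{p+1..n} - K. \<phi> j (u j)) *
        max 0 (Min ((\<lambda>i. dagger p i (\<phi> i) (u i)) ` ({1..p} \<union> K)) -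
               max_or_0 ((\<lambda>j. dagger p j (\<phi> j) (u j)) ` ({p+1..n} - K))))"

end

theory Submission
  imports Defs "HOL-Probability.Product_PMF"
begin

text \<open>The whole statement rests on the factorisations \<open>G = F * FZ\<close> for maxima and
\<open>1 - G = (1 - F) * (1 - FZ)\<close> for minima. They show that \<open>G\<close> is increasing in \<open>F\<close>, and that a generator
recovering the factor \<open>F\<close> from \<open>G\<close> has a dagger recovering \<open>FZ\<close> (\<open>dagger_shock_margin\<close>).

For the joint distribution one distinguishes which of the minima are kept small by \<open>Z\<close>: splitting
the event by the set \<open>K\<close> of those \<open>j > p\<close> with \<open>Z \<le> x j\<close> yields the sum over \<open>K\<close> that defines the copula, with \<open>F\<close> and
\<open>FZ\<close> in the places of the generators and their daggers (\<open>prob_joint_shock\<close>). Interpolation by the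
generators then gives \<open>H = C\<^sub>M\<^sub>M\<close>, up to a separate argument where \<open>G\<close> is \<open>0\<close> or \<open>1\<close> and does not determine
its factors (\<open>shock_H_eq_C_MM\<close>). Expressed by \<open>F\<close> and \<open>FZ\<close>, \<open>H\<close> is a sum of products of nonnegative
factors and hence increasing in every \<open>F i\<close>; its extrema are the values at the corners of the box.

That the extrema are attained requires shock models with prescribed distribution functions, which need
not be continuous from either side. They are cluster points of discrete product distributions in the
compact space of functions from events into the unit interval (\<open>ex_finitely_additive_product\<close>).

Three facts about generators remain. The constructed ones interpolate, because \<open>F\<close> is constant
wherever \<open>G\<close> keeps a nondegenerate value (\<open>constructed_max_interpolates\<close>). Least and greatest generators exist and interpolate:
they are the explicit envelopes \<open>sup\<^sub>x min (F x) (u / FZ x)\<close> and \<open>inf\<^sub>x max (F x) (u / FZ x)\<close>, and their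
reflections for minima. Finally the envelope below for \<open>Fl\<close> does not exceed the envelope above for
\<open>Fu\<close>, which is read off from the formulas (\<open>lower_envelope_le_upper_envelope\<close>).\<close>

section \<open>The formula behind the copula\<close>

text \<open>The right-hand side of the maxmin copula, as a function of the values \<open>a i\<close> of the generating
functions and the values \<open>z i\<close> of their daggers. With \<open>a i = F i (x i)\<close> and \<open>z i = FZ (x i)\<close> it will
turn out to be the joint distribution function of the shock model.\<close>

definition shock_formula ::
  "'i set \<Rightarrow> 'i set \<Rightarrow> ('i \<Rightarrow> real) \<Rightarrow> ('i \<Rightarrow> real) \<Rightarrow> real" where
  "shock_formula T S a z =
     (\<Prod>i\<in>T. a i) * (\<Sum>K\<in>Pow S. (\<Prod>j\<in>S - K. a j) *
        max 0 (Min (z ` (T \<union> K)) - max_or_0 (z ` (S - K))))"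

lemma C_MM_eq_shock_formula:
  "C_MM n p \<phi> u =
     shock_formula {1..p} {p+1..n} (\<lambda>i. \<phi> i (u i)) (\<lambda>i. dagger p i (\<phi> i) (u i))"
  by (simp add: C_MM_def shock_formula_def)

lemma shock_formula_mono:
  assumes "\<And>i. i \<in> T \<union> S \<Longrightarrow> 0 \<le> a i \<and> a i \<le> b i"
  shows "shock_formula T S a z \<le> shock_formula T S b z"
  unfolding shock_formula_def
  using assms
  by (intro mult_mono sum_mono prod_mono sum_nonneg mult_nonneg_nonneg prod_nonneg) 
     (fastforce intro: order_trans)+

lemma shock_formula_cong:
  assumes "\<And>i. i \<in> T \<union> S \<Longrightarrow> a i = b i" "\<And>i. i \<in> T \<union> S \<Longrightarrow> z i = w i"
  shows "shock_formula T S a z = shock_formula T S b w"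
proof -
  have "z ` (T \<union> K) = w ` (T \<union> K)" "z ` (S - K) = w ` (S - K)"
    "(\<Prod>j\<in>S - K. a j) = (\<Prod>j\<in>S - K. b j)" if "K \<subseteq> S" for K
    using that assms by (auto intro!: image_cong prod.cong)
  moreover have "(\<Prod>i\<in>T. a i) = (\<Prod>i\<in>T. b i)"
    using assms by (auto intro!: prod.cong)
  ultimately show ?thesis
    unfolding shock_formula_def by (intro arg_cong2[of _ _ _ _ "(*)"] sum.cong) auto
qed

lemma shock_formula_eq_0:
  assumes "finite T" "finite S" "i \<in> T" "a i = 0"
  shows "shock_formula T S a z = 0"
proof -
  have "(\<Prod>i\<in>T. a i) = 0"
    using assms by (intro prod_zero) auto
  then show ?thesis
    by (simp add: shock_formula_def)
qed

text \<open>This is how the copula treats a constraint that holds almost surely, where the dagger is \<open>1\<close> by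
convention. For \<open>j \<in> D\<close> the summands with \<open>j \<notin> K\<close> vanish, because the subtracted maximum is at
least \<open>1\<close>, and in the others \<open>j\<close> changes neither the product nor the minimum.\<close>

lemma shock_formula_drop_trivial:
  assumes fin: "finite T" "finite S" and T: "T \<noteq> {}" and D: "D \<subseteq> S" "D \<inter> T = {}"
    and one: "\<And>j. j \<in> D \<Longrightarrow> z j = 1" and le: "\<And>i. i \<in> T \<union> S \<Longrightarrow> z i \<le> 1"
  shows "shock_formula T S a z = shock_formula T (S - D) a z"
proof -
  define t where "t = (\<lambda>S' K. (\<Prod>j\<in>S' - K. a j) *
        max 0 (Min (z ` (T \<union> K)) - max_or_0 (z ` (S' - K))))"
  have finD: "finite D"
    using fin D finite_subset by blast
  have "(\<Sum>K\<in>Pow S. t S K) = (\<Sum>K\<in>{K\<in>Pow S. D \<subseteq> K}. t S K)"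
  proof (rule sum.mono_neutral_right)
    show "\<forall>K\<in>Pow S - {K\<in>Pow S. D \<subseteq> K}. t S K = 0"
    proof
      fix K assume "K \<in> Pow S - {K\<in>Pow S. D \<subseteq> K}"
      then obtain j where j: "j \<in> D" "j \<notin> K" "K \<subseteq> S" by blast
      have finK: "finite K" using j fin finite_subset by blast
      have "1 \<le> Max (z ` (S - K))"
        using j D fin one by (intro Max_ge_iff[THEN iffD2]) (auto intro!: bexI[of _ j])
      moreover have "S - K \<noteq> {}" using j D by blast
      moreover have "Min (z ` (T \<union> K)) \<le> 1"
        using T fin finK le j by (intro Min_le_iff[THEN iffD2]) auto
      ultimately show "t S K = 0"
        by (simp add: t_def max_or_0_def)
    qed
  qed (use fin in auto)
  also have "\<dots> = (\<Sum>K\<in>Pow (S - D). t S (K \<union> D))"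
    by (rule sum.reindex_bij_witness[of _ "\<lambda>K. K \<union> D" "\<lambda>K. K - D"])
      (use D in \<open>auto simp: Un_absorb2 intro!: arg_cong[of _ _ "t S"]\<close>)
  also have "\<dots> = (\<Sum>K\<in>Pow (S - D). t (S - D) K)"
  proof (rule sum.cong[OF refl])
    fix K assume K: "K \<in> Pow (S - D)"
    then have finK: "finite K" using fin finite_subset by blast
    have "Min (z ` (T \<union> (K \<union> D))) = Min (z ` (T \<union> K))"
    proof (cases "D = {}")
      case False
      have "Min (z ` (T \<union> K) \<union> z ` D) = min (Min (z ` (T \<union> K))) (Min (z ` D))"
        using T fin finK finD False by (intro Min_Un) auto
      moreover have "z ` D = {1}"
        using one False by auto
      moreover have "Min (z ` (T \<union> K)) \<le> 1"
        using T fin finK le K by (intro Min_le_iff[THEN iffD2]) auto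
      ultimately show ?thesis
        by (simp add: image_Un Un_assoc)
    qed simp
    moreover have "S - (K \<union> D) = S - D - K" by blast
    ultimately show "t S (K \<union> D) = t (S - D) K"
      by (simp add: t_def)
  qed
  finally show ?thesis
    by (simp add: shock_formula_def t_def)
qed

section \<open>Margins and degenerate values\<close>

text \<open>The value at a point of the distribution function of \<open>max X Z\<close> (for \<open>i \<le> p\<close>) or \<open>min X Z\<close> (for
\<open>i > p\<close>), when \<open>X\<close> and \<open>Z\<close> are independent and their distribution functions take the values \<open>a\<close>
and \<open>z\<close> there.\<close>

definition shock_margin :: "nat \<Rightarrow> nat \<Rightarrow> real \<Rightarrow> real \<Rightarrow> real" where
  "shock_margin p i a z = (if i \<le> p then a * z else 1 - (1 - a) * (1 - z))"

lemma shock_margin_mono: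
  assumes "a \<le> b" "z \<in> {0..1}"
  shows "shock_margin p i a z \<le> shock_margin p i b z"
proof (cases "i \<le> p")
  case True
  then show ?thesis
    using assms by (simp add: shock_margin_def mult_right_mono)
next
  case False
  have "(1 - b) * (1 - z) \<le> (1 - a) * (1 - z)"
    using assms by (intro mult_right_mono) auto
  then show ?thesis
    using False by (simp add: shock_margin_def)
qed

lemma shock_margin_range:
  assumes "a \<in> {0..1}" "z \<in> {0..1}"
  shows "shock_margin p i a z \<in> {0..1}"
proof -
  have "0 \<le> shock_margin p i 0 z" "shock_margin p i 1 z \<le> 1"
    using assms by (auto simp: shock_margin_def)
  then show ?thesis
    using shock_margin_mono[of 0 a z p i] shock_margin_mono[of a 1 z p i] assms by auto
qed

text \<open>At a degenerate value of \<open>G\<close> the factors \<open>F\<close> and \<open>FZ\<close> cannot be recovered: \<open>0 = a * z\<close> does not tell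
which factor vanishes. A generator can recover them at the nondegenerate values only.\<close>

definition nondegenerate :: "nat \<Rightarrow> nat \<Rightarrow> real \<Rightarrow> bool" where
  "nondegenerate p i u \<longleftrightarrow> (if i \<le> p then 0 < u else u < 1)"

text \<open>A generator that recovers \<open>F\<close> from \<open>G\<close> lets its dagger recover the other factor \<open>FZ\<close>: this is division
by the first factor, applied to \<open>1 - G = (1 - F) * (1 - FZ)\<close> in the second case.\<close>

lemma dagger_shock_margin:
  assumes "nondegenerate p i (shock_margin p i a z)" "f (shock_margin p i a z) = a"
  shows "dagger p i f (shock_margin p i a z) = z"
proof (cases "i \<le> p")
  case True
  then show ?thesis
    using assms by (auto simp: dagger_def shock_margin_def nondegenerate_def)
next
  case False
  then have "shock_margin p i a z - a = z * (1 - a)"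
    by (simp add: shock_margin_def algebra_simps)
  moreover have "a \<noteq> 1"
    using False assms(1) by (auto simp: shock_margin_def nondegenerate_def)
  ultimately show ?thesis
    using False assms by (simp add: dagger_def nondegenerate_def)
qed

section \<open>Finitely additive probabilities\<close>

locale finitely_additive_probability =
  fixes \<Omega> :: "'a set" and M P
  assumes fap: "fin_add_prob \<Omega> M P"
begin

sublocale algebra \<Omega> M
  using fap by (simp add: fin_add_prob_def)

lemma prob_add: "A \<in> M \<Longrightarrow> B \<in> M \<Longrightarrow> A \<inter> B = {} \<Longrightarrow> P (A \<union> B) = P A + P B"
  using fap by (simp add: fin_add_prob_def additive_def)

lemma prob_nonneg: "A \<in> M \<Longrightarrow> 0 \<le> P A"
  using fap by (simp add: fin_add_prob_def)

lemma prob_space: "P \<Omega> = 1"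
  using fap by (simp add: fin_add_prob_def)

lemma prob_empty: "P {} = 0"
  using prob_add[of "{}" "{}"] by simp

lemma prob_diff:
  assumes "A \<in> M" "B \<in> M" "A \<subseteq> B"
  shows "P (B - A) = P B - P A"
proof -
  have "A \<union> (B - A) = B" using assms(3) by blast
  then show ?thesis
    using prob_add[of A "B - A"] Diff[OF assms(2,1)] assms(1) by simp
qed

lemma prob_mono: "A \<in> M \<Longrightarrow> B \<in> M \<Longrightarrow> A \<subseteq> B \<Longrightarrow> P A \<le> P B"
  using prob_diff[of A B] prob_nonneg[of "B - A"] by auto

lemma prob_Compl: "A \<in> M \<Longrightarrow> P (\<Omega> - A) = 1 - P A"
  using prob_diff[of A \<Omega>] sets_into_space prob_space by auto

lemma prob_inter_full:
  assumes "A \<in> M" "B \<in> M" "P B = 1"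
  shows "P (A \<inter> B) = P A"
proof -
  have "P (A - B) \<le> P (\<Omega> - B)"
    using assms sets_into_space by (intro prob_mono) auto
  then have "P (A - B) = 0"
    using prob_Compl[of B] prob_nonneg[of "A - B"] assms by auto
  moreover have "P (A \<inter> B \<union> (A - B)) = P (A \<inter> B) + P (A - B)"
    using assms by (intro prob_add) auto
  moreover have "A \<inter> B \<union> (A - B) = A" by blast
  ultimately show ?thesis by simp
qed

lemma prob_UN:
  assumes "finite I" "\<And>i. i \<in> I \<Longrightarrow> A i \<in> M" "disjoint_family_on A I"
  shows "P (\<Union>i\<in>I. A i) = (\<Sum>i\<in>I. P (A i))"
  using assms
proof (induction I rule: finite_induct)
  case (insert i I)
  have "P (A i \<union> (\<Union>i\<in>I. A i)) = P (A i) + P (\<Union>i\<in>I. A i)"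
    using insert by (intro prob_add finite_UN) (auto simp: disjoint_family_on_def)
  then show ?case
    using insert by (simp add: disjoint_family_on_insert)
qed (simp add: prob_empty)

lemma prob_inter_full_family:
  assumes "finite I" "A \<in> M" "\<And>i. i \<in> I \<Longrightarrow> B i \<in> M \<and> P (B i) = 1"
  shows "P {\<omega>\<in>A. \<forall>i\<in>I. \<omega> \<in> B i} = P A"
  using assms(1,3)
proof (induction I rule: finite_induct)
  case (insert i I)
  have "A \<inter> {\<omega>\<in>\<Omega>. \<forall>i\<in>I. \<omega> \<in> B i} \<in> M"
    using insert assms(2) sets_into_space
    by (intro Int sets_Collect_finite_All) (auto simp: Collect_conj_eq Int_absorb1)
  moreover have "A \<inter> {\<omega>\<in>\<Omega>. \<forall>i\<in>I. \<omega> \<in> B i} = {\<omega>\<in>A. \<forall>i\<in>I. \<omega> \<in> B i}"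
    using sets_into_space[OF assms(2)] by blast
  ultimately have "{\<omega>\<in>A. \<forall>i\<in>I. \<omega> \<in> B i} \<in> M" by simp
  then have "P ({\<omega>\<in>A. \<forall>i\<in>I. \<omega> \<in> B i} \<inter> B i) = P {\<omega>\<in>A. \<forall>i\<in>I. \<omega> \<in> B i}"
    using insert by (intro prob_inter_full) auto
  moreover have "{\<omega>\<in>A. \<forall>i\<in>insert i I. \<omega> \<in> B i} = {\<omega>\<in>A. \<forall>i\<in>I. \<omega> \<in> B i} \<inter> B i"
    by auto
  ultimately show ?case
    using insert by simp
qed simp

end

section \<open>Distribution of the shock model\<close>

lemma ereal_interval_intros [simp]:
  "ereal_interval UNIV" "ereal_interval {..a}" "ereal_interval {a<..}"
  by (auto simp: ereal_interval_def)

locale shock_model_space =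
  fixes n p :: nat and \<Omega> M P and X :: "nat \<Rightarrow> 'a \<Rightarrow> ereal" and Z F FZ
  assumes model: "shock_model n \<Omega> M P X Z F FZ"
    and dist: "\<And>i. i \<in> {1..n} \<Longrightarrow> dist_fun (F i)" "dist_fun FZ"
begin

sublocale finitely_additive_probability \<Omega> M P
  using model by unfold_locales (simp add: shock_model_def)

lemma X_event: "i \<in> {1..n} \<Longrightarrow> ereal_interval I \<Longrightarrow> {\<omega>\<in>\<Omega>. X i \<omega> \<in> I} \<in> M"
  using model by (simp add: shock_model_def rand_var_def)

lemma Z_event: "ereal_interval I \<Longrightarrow> {\<omega>\<in>\<Omega>. Z \<omega> \<in> I} \<in> M"
  using model by (simp add: shock_model_def rand_var_def)

lemma prob_X_le: "i \<in> {1..n} \<Longrightarrow> P {\<omega>\<in>\<Omega>. X i \<omega> \<le> x} = F i x"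
  using model unfolding shock_model_def by (auto simp: cdf_of_def dest!: bspec[of _ _ i] fun_cong[of _ _ x])

lemma prob_Z_le: "P {\<omega>\<in>\<Omega>. Z \<omega> \<le> x} = FZ x"
  using model by (auto simp: shock_model_def cdf_of_def)

lemma prob_X_gt: "i \<in> {1..n} \<Longrightarrow> P {\<omega>\<in>\<Omega>. X i \<omega> > x} = 1 - F i x"
  using prob_Compl[OF X_event[of i "{..x}"]] prob_X_le[of i x]
  by (simp add: not_le set_diff_eq cong: conj_cong)

lemma prob_Z_gt: "P {\<omega>\<in>\<Omega>. Z \<omega> > x} = 1 - FZ x"
  using prob_Compl[OF Z_event[of "{..x}"]] prob_Z_le[of x]
  by (simp add: not_le set_diff_eq cong: conj_cong)

lemma prob_Z_between: "P {\<omega>\<in>\<Omega>. a < Z \<omega> \<and> Z \<omega> \<le> b} = max 0 (FZ b - FZ a)"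
proof (cases "a \<le> b")
  case True
  have "P ({\<omega>\<in>\<Omega>. Z \<omega> \<in> {..b}} - {\<omega>\<in>\<Omega>. Z \<omega> \<in> {..a}}) = FZ b - FZ a"
  proof -
    have "{\<omega>\<in>\<Omega>. Z \<omega> \<in> {..a}} \<subseteq> {\<omega>\<in>\<Omega>. Z \<omega> \<in> {..b}}"
      using True by auto
    from prob_diff[OF Z_event Z_event this] show ?thesis
      by (simp add: prob_Z_le)
  qed
  moreover have "{\<omega>\<in>\<Omega>. Z \<omega> \<in> {..b}} - {\<omega>\<in>\<Omega>. Z \<omega> \<in> {..a}} = {\<omega>\<in>\<Omega>. a < Z \<omega> \<and> Z \<omega> \<le> b}"
    by auto
  moreover have "FZ a \<le> FZ b"
    using dist True by (simp add: dist_fun_def mono_def)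
  ultimately show ?thesis by simp
next
  case False
  then have "{\<omega>\<in>\<Omega>. a < Z \<omega> \<and> Z \<omega> \<le> b} = {}" by auto
  then have "P {\<omega>\<in>\<Omega>. a < Z \<omega> \<and> Z \<omega> \<le> b} = 0" by (simp only: prob_empty)
  moreover have "FZ b \<le> FZ a"
    using dist False by (simp add: dist_fun_def mono_def)
  ultimately show ?thesis by simp
qed

lemma prob_product:
  assumes "A \<subseteq> {1..n}" "\<And>i. i \<in> A \<Longrightarrow> ereal_interval (I i)" "ereal_interval J"
  shows "P {\<omega>\<in>\<Omega>. (\<forall>i\<in>A. X i \<omega> \<in> I i) \<and> Z \<omega> \<in> J} =
     (\<Prod>i\<in>A. P {\<omega>\<in>\<Omega>. X i \<omega> \<in> I i}) * P {\<omega>\<in>\<Omega>. Z \<omega> \<in> J}"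
proof -
  define I' where "I' = (\<lambda>i. if i \<in> A then I i else UNIV)"
  have "P {\<omega>\<in>\<Omega>. (\<forall>i\<in>{1..n}. X i \<omega> \<in> I' i) \<and> Z \<omega> \<in> J} =
     (\<Prod>i\<in>{1..n}. P {\<omega>\<in>\<Omega>. X i \<omega> \<in> I' i}) * P {\<omega>\<in>\<Omega>. Z \<omega> \<in> J}"
    using model assms by (simp add: shock_model_def indep_on_intervals_def I'_def)
  moreover have "(\<forall>i\<in>{1..n}. X i \<omega> \<in> I' i) \<longleftrightarrow> (\<forall>i\<in>A. X i \<omega> \<in> I i)" for \<omega>
    using assms(1) by (auto simp: I'_def)
  moreover have "(\<Prod>i\<in>{1..n}. P {\<omega>\<in>\<Omega>. X i \<omega> \<in> I' i}) = (\<Prod>i\<in>A. P {\<omega>\<in>\<Omega>. X i \<omega> \<in> I i})"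
    by (rule prod.mono_neutral_cong_right) (use assms(1) prob_space in \<open>auto simp: I'_def\<close>)
  ultimately show ?thesis by simp
qed

lemma U_event:
  assumes "i \<in> {1..n}"
  shows "{\<omega>\<in>\<Omega>. shock_U p X Z i \<omega> \<le> x} \<in> M"
proof -
  have X: "{\<omega>\<in>\<Omega>. X i \<omega> \<le> x} \<in> M" and Z: "{\<omega>\<in>\<Omega>. Z \<omega> \<le> x} \<in> M"
    using X_event[OF assms, of "{..x}"] Z_event[of "{..x}"] by simp_all
  show ?thesis
    using sets_Collect_conj[OF Z X] sets_Collect_disj[OF Z X]
    by (cases "i \<le> p") (simp_all add: shock_U_def min_le_iff_disj)
qed

lemma shock_G_eq:
  assumes i: "i \<in> {1..n}"
  shows "shock_G p \<Omega> P X Z i x = shock_margin p i (F i x) (FZ x)"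
proof (cases "i \<le> p")
  case True
  then have "shock_G p \<Omega> P X Z i x = P {\<omega>\<in>\<Omega>. (\<forall>k\<in>{i}. X k \<omega> \<in> {..x}) \<and> Z \<omega> \<in> {..x}}"
    by (simp add: shock_G_def cdf_of_def shock_U_def)
  also have "\<dots> = F i x * FZ x"
    using i by (subst prob_product) (auto simp: prob_X_le prob_Z_le)
  finally show ?thesis
    using True by (simp add: shock_margin_def)
next
  case False
  have "\<Omega> - {\<omega>\<in>\<Omega>. shock_U p X Z i \<omega> \<le> x} = {\<omega>\<in>\<Omega>. (\<forall>k\<in>{i}. X k \<omega> \<in> {x<..}) \<and> Z \<omega> \<in> {x<..}}"
    using False by (auto simp: shock_U_def min_le_iff_disj not_le)
  moreover have "P {\<omega>\<in>\<Omega>. (\<forall>k\<in>{i}. X k \<omega> \<in> {x<..}) \<and> Z \<omega> \<in> {x<..}} = (1 - F i x) * (1 - FZ x)"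
    using i by (subst prob_product) (auto simp: prob_X_gt prob_Z_gt)
  ultimately have "1 - shock_G p \<Omega> P X Z i x = (1 - F i x) * (1 - FZ x)"
    using prob_Compl[OF U_event[OF i, of x]] by (simp add: shock_G_def cdf_of_def)
  then show ?thesis
    using False by (simp add: shock_margin_def)
qed

text \<open>The event splits according to the set \<open>K \<subseteq> S\<close> of those \<open>j\<close> with \<open>Z \<le> x j\<close>. On the part belonging to \<open>K\<close>
the requirements decouple: \<open>X i \<le> x i\<close> for \<open>i \<in> T \<union> (S - K)\<close>, and \<open>Z\<close> lies in the interval between the
largest \<open>x j\<close> with \<open>j \<in> S - K\<close> and the smallest \<open>x i\<close> with \<open>i \<in> T \<union> K\<close>. Independence turns each part into
one summand. General \<open>T\<close> and \<open>S\<close> are needed because almost surely satisfied constraints will be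
dropped.\<close>

lemma prob_joint_shock:
  assumes T: "T \<subseteq> {1..n}" "T \<noteq> {}" "\<And>i. i \<in> T \<Longrightarrow> i \<le> p"
    and S: "S \<subseteq> {1..n}" "\<And>j. j \<in> S \<Longrightarrow> p < j"
  shows "P {\<omega>\<in>\<Omega>. \<forall>i\<in>T \<union> S. shock_U p X Z i \<omega> \<le> x i} =
     shock_formula T S (\<lambda>i. F i (x i)) (\<lambda>i. FZ (x i))"
proof -
  \<comment> \<open>The cells of the decomposition: \<open>J K\<close> is the interval that \<open>Z\<close> must hit on the cell \<open>E K\<close>.\<close>
  define J where "J = (\<lambda>K. {z. (\<forall>i\<in>T \<union> K. z \<le> x i) \<and> (\<forall>j\<in>S - K. x j < z)})"
  define E where "E = (\<lambda>K. {\<omega>\<in>\<Omega>. (\<forall>i\<in>T \<union> (S - K). X i \<omega> \<in> {..x i}) \<and> Z \<omega> \<in> J K})"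
  have fin: "finite T" "finite S"
    using T S finite_subset by blast+
  have disj: "T \<inter> S = {}"
    using T S by force
  have intJ: "ereal_interval (J K)" for K
    unfolding ereal_interval_def J_def by (auto intro: order_trans less_le_trans)
  have E: "E K \<in> M" if "K \<subseteq> S" for K
    unfolding E_def using T S that fin
    by (intro sets_Collect_conj sets_Collect_finite_All X_event Z_event intJ) auto
  have monoZ: "mono FZ"
    using dist by (simp add: dist_fun_def)
  \<comment> \<open>Monotonicity of \<open>FZ\<close> moves it inside the minimum and the maximum of the \<open>x i\<close>.\<close>
  have PJ: "P {\<omega>\<in>\<Omega>. Z \<omega> \<in> J K} =
      max 0 (Min ((\<lambda>i. FZ (x i)) ` (T \<union> K)) - max_or_0 ((\<lambda>i. FZ (x i)) ` (S - K)))"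
    if K: "K \<subseteq> S" for K
  proof -
    have finK: "finite K" using K fin finite_subset by blast
    let ?m = "Min (x ` (T \<union> K))"
    have m: "z \<le> ?m \<longleftrightarrow> (\<forall>i\<in>T \<union> K. z \<le> x i)" for z
      using T fin finK by (subst Min_ge_iff) auto
    have FZm: "FZ ?m = Min ((\<lambda>i. FZ (x i)) ` (T \<union> K))"
      using T fin finK by (subst mono_Min_commute[OF monoZ]) (auto simp: image_image)
    show ?thesis
    proof (cases "S - K = {}")
      case True
      have "J K = {..?m}"
        unfolding J_def True by (auto simp: m)
      then have "P {\<omega>\<in>\<Omega>. Z \<omega> \<in> J K} = FZ ?m"
        by (simp add: prob_Z_le)
      moreover have "0 \<le> FZ ?m"
        using dist by (auto simp: dist_fun_def)
      ultimately show ?thesis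
        unfolding FZm[symmetric] True by (simp add: max_or_0_def)
    next
      case False
      let ?M = "Max (x ` (S - K))"
      have M: "?M < z \<longleftrightarrow> (\<forall>j\<in>S - K. x j < z)" for z
        using fin False by (subst Max_less_iff) auto
      have FZM: "FZ ?M = max_or_0 ((\<lambda>i. FZ (x i)) ` (S - K))"
        using fin False by (subst mono_Max_commute[OF monoZ]) (auto simp: image_image max_or_0_def)
      have "J K = {z. ?M < z \<and> z \<le> ?m}"
        unfolding J_def by (auto simp only: m M)
      then show ?thesis
        using prob_Z_between[of ?M ?m] by (simp only: FZm[symmetric] FZM[symmetric] mem_Collect_eq)
    qed
  qed
  have "shock_U p X Z i \<omega> \<le> x i \<longleftrightarrow> X i \<omega> \<le> x i \<and> Z \<omega> \<le> x i" if "i \<in> T" for i \<omega>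
    using T(3)[OF that] by (simp add: shock_U_def)
  moreover have "shock_U p X Z j \<omega> \<le> x j \<longleftrightarrow> X j \<omega> \<le> x j \<or> Z \<omega> \<le> x j" if "j \<in> S" for j \<omega>
    using S(2)[OF that] by (simp add: shock_U_def min_le_iff_disj)
  ultimately have U: "(\<forall>i\<in>T \<union> S. shock_U p X Z i \<omega> \<le> x i) \<longleftrightarrow>
      (\<forall>i\<in>T. X i \<omega> \<le> x i \<and> Z \<omega> \<le> x i) \<and> (\<forall>j\<in>S. X j \<omega> \<le> x j \<or> Z \<omega> \<le> x j)" for \<omega>
    by blast
  have "{\<omega>\<in>\<Omega>. \<forall>i\<in>T \<union> S. shock_U p X Z i \<omega> \<le> x i} = (\<Union>K\<in>Pow S. E K)"
  proof (intro subset_antisym subsetI)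
    fix \<omega> assume "\<omega> \<in> {\<omega>\<in>\<Omega>. \<forall>i\<in>T \<union> S. shock_U p X Z i \<omega> \<le> x i}"
    then have \<omega>: "\<omega> \<in> \<Omega>" "\<forall>i\<in>T. X i \<omega> \<le> x i \<and> Z \<omega> \<le> x i"
        "\<forall>j\<in>S. X j \<omega> \<le> x j \<or> Z \<omega> \<le> x j"
      using U by simp_all
    have "X j \<omega> \<le> x j" if "j \<in> S" "\<not> Z \<omega> \<le> x j" for j
      using bspec[OF \<omega>(3) that(1)] that(2) by blast
    then have "\<forall>i\<in>T \<union> (S - {j\<in>S. Z \<omega> \<le> x j}). X i \<omega> \<in> {..x i}"
      using \<omega>(2) by (simp add: ball_Un)
    moreover have "Z \<omega> \<in> J {j\<in>S. Z \<omega> \<le> x j}"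
      using \<omega>(2) by (simp add: J_def ball_Un not_le)
    ultimately have "\<omega> \<in> E {j\<in>S. Z \<omega> \<le> x j}"
      unfolding E_def using \<omega>(1) by simp
    then show "\<omega> \<in> (\<Union>K\<in>Pow S. E K)"
      by (rule UN_I[rotated]) simp
  next
    fix \<omega> assume "\<omega> \<in> (\<Union>K\<in>Pow S. E K)"
    then obtain K where "K \<subseteq> S" "\<omega> \<in> E K" by blast
    then have "\<omega> \<in> \<Omega>" "\<forall>i\<in>T \<union> (S - K). X i \<omega> \<le> x i" "\<forall>i\<in>T \<union> K. Z \<omega> \<le> x i"
      by (simp_all add: E_def J_def)
    then have "\<omega> \<in> \<Omega> \<and> (\<forall>i\<in>T. X i \<omega> \<le> x i \<and> Z \<omega> \<le> x i) \<and> (\<forall>j\<in>S. X j \<omega> \<le> x j \<or> Z \<omega> \<le> x j)"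
      by blast
    then show "\<omega> \<in> {\<omega>\<in>\<Omega>. \<forall>i\<in>T \<union> S. shock_U p X Z i \<omega> \<le> x i}"
      by (simp add: U)
  qed
  moreover have "disjoint_family_on E (Pow S)"
    unfolding disjoint_family_on_def
  proof (intro ballI impI)
    fix K L assume KL: "K \<in> Pow S" "L \<in> Pow S" "K \<noteq> L"
    then obtain j where "j \<in> S" "j \<in> K \<longleftrightarrow> j \<notin> L" by blast
    then consider "j \<in> K" "j \<in> S - L" | "j \<in> L" "j \<in> S - K" by blast
    then have "\<not> (z \<in> J K \<and> z \<in> J L)" for z
    proof cases
      case 1
      then have "z \<in> J K \<Longrightarrow> z \<le> x j" "z \<in> J L \<Longrightarrow> x j < z" by (simp_all add: J_def)
      then show ?thesis by (meson leD)
    next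
      case 2
      then have "z \<in> J L \<Longrightarrow> z \<le> x j" "z \<in> J K \<Longrightarrow> x j < z" by (simp_all add: J_def)
      then show ?thesis by (meson leD)
    qed
    then show "E K \<inter> E L = {}"
      unfolding E_def by blast
  qed
  ultimately have "P {\<omega>\<in>\<Omega>. \<forall>i\<in>T \<union> S. shock_U p X Z i \<omega> \<le> x i} = (\<Sum>K\<in>Pow S. P (E K))"
    using fin E prob_UN[of "Pow S" E] by auto
  also have "\<dots> = (\<Sum>K\<in>Pow S. (\<Prod>i\<in>T. F i (x i)) * ((\<Prod>j\<in>S - K. F j (x j)) *
      max 0 (Min ((\<lambda>i. FZ (x i)) ` (T \<union> K)) - max_or_0 ((\<lambda>i. FZ (x i)) ` (S - K)))))"
  proof (rule sum.cong[OF refl])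
    fix K assume K: "K \<in> Pow S"
    have "P (E K) = (\<Prod>i\<in>T \<union> (S - K). F i (x i)) * P {\<omega>\<in>\<Omega>. Z \<omega> \<in> J K}"
      unfolding E_def using T(1) S(1)
      by (subst prob_product[OF _ _ intJ]) (auto simp: prob_X_le subset_iff intro!: prod.cong)
    also have "(\<Prod>i\<in>T \<union> (S - K). F i (x i)) = (\<Prod>i\<in>T. F i (x i)) * (\<Prod>j\<in>S - K. F j (x j))"
      using fin disj by (intro prod.union_disjoint) auto
    finally show "P (E K) = (\<Prod>i\<in>T. F i (x i)) * ((\<Prod>j\<in>S - K. F j (x j)) *
      max 0 (Min ((\<lambda>i. FZ (x i)) ` (T \<union> K)) - max_or_0 ((\<lambda>i. FZ (x i)) ` (S - K))))"
      using PJ K by simp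
  qed
  finally show ?thesis
    by (simp add: shock_formula_def sum_distrib_left)
qed

end

context shock_model_space
begin

lemma H_event: "A \<subseteq> {1..n} \<Longrightarrow> {\<omega>\<in>\<Omega>. \<forall>i\<in>A. shock_U p X Z i \<omega> \<le> x i} \<in> M"
  by (intro sets_Collect_finite_All U_event) (auto intro: finite_subset)

lemma prob_U_le: "i \<in> {1..n} \<Longrightarrow>
    P {\<omega>\<in>\<Omega>. shock_U p X Z i \<omega> \<le> x} = shock_margin p i (F i x) (FZ x)"
  using shock_G_eq[of i x] by (simp add: shock_G_def cdf_of_def)

lemma shock_H_eq_formula:
  assumes "1 \<le> p" "p < n"
  shows "shock_H n p \<Omega> P X Z x =
    shock_formula {1..p} {p+1..n} (\<lambda>i. F i (x i)) (\<lambda>i. FZ (x i))"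
proof -
  have split: "{1..n} = {1..p} \<union> {p+1..n}" using assms by auto
  show ?thesis
    unfolding shock_H_def split by (rule prob_joint_shock) (use assms in auto)
qed

text \<open>At nondegenerate values the copula reads off \<open>F\<close> and \<open>FZ\<close> and coincides with the formula for the joint
distribution. If some \<open>G i (x i)\<close> with \<open>i \<le> p\<close> is \<open>0\<close>, both sides are \<open>0\<close>. The indices \<open>j > p\<close> with
\<open>G j (x j) = 1\<close> are those whose constraint holds almost surely; dropping them changes neither the
probability nor, by \<open>shock_formula_drop_trivial\<close>, the copula.\<close>

lemma shock_H_eq_C_MM:
  fixes \<phi> :: "nat \<Rightarrow> real \<Rightarrow> real"
  assumes p: "1 \<le> p" "p < n"
    and G: "\<And>i x. i \<in> {1..n} \<Longrightarrow> G i x = shock_margin p i (F i x) (FZ x)"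
    and ends: "\<And>i. i \<in> {1..n} \<Longrightarrow> \<phi> i 0 = 0 \<and> \<phi> i 1 = 1"
    and interp: "\<And>i x. i \<in> {1..n} \<Longrightarrow> nondegenerate p i (G i x) \<Longrightarrow> \<phi> i (G i x) = F i x"
  shows "shock_H n p \<Omega> P X Z x = C_MM n p \<phi> (\<lambda>i. G i (x i))"
proof -
  let ?T = "{1..p}" and ?S = "{p+1..n}"
  let ?a = "\<lambda>i. \<phi> i (G i (x i))" and ?z = "\<lambda>i. dagger p i (\<phi> i) (G i (x i))"
  let ?E = "\<lambda>A. {\<omega>\<in>\<Omega>. \<forall>i\<in>A. shock_U p X Z i \<omega> \<le> x i}"
  have split: "{1..n} = ?T \<union> ?S" using p by auto
  have range: "F i t \<in> {0..1}" "FZ t \<in> {0..1}" if "i \<in> {1..n}" for i t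
    using dist(1)[OF that] dist(2) by (auto simp: dist_fun_def)
  have rangeG: "G i t \<in> {0..1}" if "i \<in> {1..n}" for i t
    using shock_margin_range range[OF that] G[OF that] by simp
  have dag: "?z i = FZ (x i)" if "i \<in> {1..n}" "nondegenerate p i (G i (x i))" for i
    using dagger_shock_margin[of p i "F i (x i)" "FZ (x i)" "\<phi> i"] interp[OF that] that G by simp
  show ?thesis
  proof (cases "\<exists>i\<in>?T. G i (x i) = 0")
    case True
    then obtain i where i: "i \<in> ?T" "i \<in> {1..n}" "G i (x i) = 0" using p by auto
    have "P (?E {1..n}) \<le> P (?E {i})"
      using i by (intro prob_mono H_event) auto
    also have "\<dots> = 0"
      using prob_U_le[OF i(2)] G[OF i(2)] i(3) by simp
    finally have "shock_H n p \<Omega> P X Z x = 0"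
      using prob_nonneg[OF H_event[of "{1..n}" x]] by (simp add: shock_H_def)
    moreover have "C_MM n p \<phi> (\<lambda>i. G i (x i)) = 0"
      unfolding C_MM_eq_shock_formula using i ends by (intro shock_formula_eq_0[of _ _ i]) auto
    ultimately show ?thesis by simp
  next
    case False
    define D where "D = {j\<in>?S. G j (x j) = 1}"
    have nondeg: "nondegenerate p i (G i (x i))" if "i \<in> ?T \<union> (?S - D)" for i
    proof -
      have "i \<in> {1..n}" using that split by blast
      then show ?thesis
        using that False rangeG[of i "x i"] by (auto simp: nondegenerate_def D_def less_le)
    qed
    have oneD: "?z j = 1" if "j \<in> D" for j
      using that by (simp add: D_def dagger_def)
    have "C_MM n p \<phi> (\<lambda>i. G i (x i)) = shock_formula ?T ?S ?a ?z"
      by (rule C_MM_eq_shock_formula)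
    also have "\<dots> = shock_formula ?T (?S - D) ?a ?z"
    proof (rule shock_formula_drop_trivial)
      fix i assume i: "i \<in> ?T \<union> ?S"
      show "?z i \<le> 1"
      proof (cases "i \<in> D")
        case False
        then have "i \<in> {1..n}" "nondegenerate p i (G i (x i))"
          using i nondeg split by blast+
        then show ?thesis
          using dag range by simp
      qed (simp add: oneD)
    qed (use p oneD in \<open>auto simp: D_def\<close>)
    also have "\<dots> = shock_formula ?T (?S - D) (\<lambda>i. F i (x i)) (\<lambda>i. FZ (x i))"
      by (rule shock_formula_cong; rule interp dag) (use nondeg split in blast)+
    also have "\<dots> = P (?E (?T \<union> (?S - D)))"
      using p by (intro prob_joint_shock[symmetric]) auto
    also have "\<dots> = P {\<omega>\<in>?E (?T \<union> (?S - D)). \<forall>j\<in>D. \<omega> \<in> ?E {j}}"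
    proof (rule prob_inter_full_family[symmetric])
      show "?E (?T \<union> (?S - D)) \<in> M"
        using split by (intro H_event) blast
      fix j assume "j \<in> D"
      then have "j \<in> {1..n}" "G j (x j) = 1"
        using split by (auto simp: D_def)
      then show "?E {j} \<in> M \<and> P (?E {j}) = 1"
        using H_event[of "{j}" x] prob_U_le[of j "x j"] G[of j "x j"] by simp
    qed (simp add: D_def)
    also have "{\<omega>\<in>?E (?T \<union> (?S - D)). \<forall>j\<in>D. \<omega> \<in> ?E {j}} = ?E {1..n}"
      unfolding split by (auto simp: D_def)
    finally show ?thesis
      by (simp add: shock_H_def)
  qed
qed

end

section \<open>Existence of shock models\<close>

text \<open>The increments of \<open>F\<close> along a finite chain telescope; they are the weights of a discrete distribution
that agrees with \<open>F\<close> on the chain.\<close>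

lemma sum_increments:
  fixes F :: "'b::linorder \<Rightarrow> real"
  assumes "finite B" "mono F" "\<And>b. 0 \<le> F b"
  shows "(\<Sum>b\<in>B. F b - Max (insert 0 (F ` {c\<in>B. c < b}))) = Max (insert 0 (F ` B))"
  using assms(1)
proof (induction B rule: finite_linorder_max_induct)
  case (insert b B)
  have "{c\<in>insert b B. c < a} = {c\<in>B. c < a}" if "a \<in> B" for a
    using insert that by auto
  moreover have "{c\<in>insert b B. c < b} = B" and "b \<notin> B"
    using insert by auto
  moreover have "Max (insert 0 (F ` insert b B)) = F b"
    using insert assms(3) monoD[OF assms(2)] by (intro Max_eqI) (auto simp: less_imp_le)
  ultimately show ?case
    using insert by simp
qed simp

lemma ex_pmf_matching_dist_fun:
  assumes F: "dist_fun F" and A: "finite A"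
  shows "\<exists>q. \<forall>x\<in>A. measure_pmf.prob q {..x} = F x"
proof -
  \<comment> \<open>The point \<open>\<infinity>\<close> is added so that the weights sum up to \<open>F \<infinity> = 1\<close>.\<close>
  define B where "B = insert \<infinity> A"
  define w where "w = (\<lambda>b. if b \<in> B then F b - Max (insert 0 (F ` {c\<in>B. c < b})) else 0)"
  have finB: "finite B" using A by (simp add: B_def)
  have mono: "mono F" and nonneg: "\<And>x. 0 \<le> F x" and top: "F \<infinity> = 1"
    using F by (auto simp: dist_fun_def)
  have w: "0 \<le> w b" for b
    using finB nonneg monoD[OF mono] by (auto simp: w_def less_imp_le)
  have cdf: "(\<Sum>b\<in>{b\<in>B. b \<le> x}. w b) = F x" if x: "x \<in> B" for x
  proof -
    let ?B = "{b\<in>B. b \<le> x}"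
    have "{c\<in>?B. c < b} = {c\<in>B. c < b}" if "b \<in> ?B" for b
      using that by auto
    then have "(\<Sum>b\<in>?B. w b) = (\<Sum>b\<in>?B. F b - Max (insert 0 (F ` {c\<in>?B. c < b})))"
      by (intro sum.cong) (auto simp: w_def)
    also have "\<dots> = Max (insert 0 (F ` ?B))"
      using finB mono nonneg by (intro sum_increments) auto
    also have "\<dots> = F x"
      using finB x nonneg monoD[OF mono] by (intro Max_eqI) auto
    finally show ?thesis .
  qed
  have "(\<integral>\<^sup>+b. ennreal (w b) \<partial>count_space UNIV) = (\<Sum>b\<in>B. ennreal (w b))"
    by (rule nn_integral_count_space'[OF finB]) (auto simp: w_def)
  also have "\<dots> = ennreal (\<Sum>b\<in>B. w b)"
    by (simp add: sum_ennreal w)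
  also have "(\<Sum>b\<in>B. w b) = 1"
    using cdf[of \<infinity>] top by (simp, simp add: B_def)
  finally have total: "(\<integral>\<^sup>+b. ennreal (w b) \<partial>count_space UNIV) = 1" by simp
  have pmf: "pmf (embed_pmf w) b = w b" for b
    using w total by (rule pmf_embed_pmf)
  have "measure_pmf.prob (embed_pmf w) {..x} = F x" if x: "x \<in> A" for x
  proof -
    have "measure_pmf.prob (embed_pmf w) {..x} = measure_pmf.prob (embed_pmf w) {b\<in>B. b \<le> x}"
      by (rule measure_prob_cong_0) (auto simp: pmf, auto simp: w_def)
    also have "\<dots> = F x"
      using finB x cdf[of x] by (subst measure_measure_pmf_finite) (simp_all add: pmf, simp add: B_def)
    finally show ?thesis .
  qed
  then show ?thesis by blast
qed

text \<open>Tychonoff: the functions from any index set into the unit interval form a compact space in the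
topology of pointwise convergence.\<close>

lemma compact_unit_functions: "compact {P :: 'b \<Rightarrow> real. \<forall>E. P E \<in> {0..1}}"
proof -
  have "compactin (product_topology (\<lambda>_. euclidean) UNIV) (PiE (UNIV :: 'b set) (\<lambda>_. {0..1::real}))"
    by (simp add: compactin_PiE)
  then show ?thesis
    by (simp add: euclidean_product_topology PiE_def Pi_def)
qed

text \<open>A cluster point inherits every closed property that holds eventually. Applied to probabilities viewed
as functions on events, this passes from discrete approximations to a finitely additive limit,
because additivity, product formulas and prescribed values are pointwise closed conditions.\<close>

lemma ex_cluster_function:
  fixes Q :: "'c \<Rightarrow> 'b \<Rightarrow> real"
  assumes "\<F> \<noteq> bot" "\<And>c E. Q c E \<in> {0..1}"
  obtains P where "\<And>C. closed C \<Longrightarrow> eventually (\<lambda>c. Q c \<in> C) \<F> \<Longrightarrow> P \<in> C"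
proof -
  have "filtermap Q \<F> \<noteq> bot"
    using assms(1) by (simp add: filtermap_bot_iff)
  moreover have "eventually (\<lambda>P. P \<in> {P. \<forall>E. P E \<in> {0..1}}) (filtermap Q \<F>)"
    using assms(2) by (simp add: eventually_filtermap)
  ultimately obtain P where P: "inf (nhds P) (filtermap Q \<F>) \<noteq> bot"
    using compact_unit_functions[unfolded compact_filter] by blast
  have "P \<in> C" if C: "closed C" and ev: "eventually (\<lambda>c. Q c \<in> C) \<F>" for C
  proof (rule ccontr)
    assume "P \<notin> C"
    then have "eventually (\<lambda>P. P \<in> - C) (nhds P)"
      using C by (intro eventually_nhds_in_open) auto
    moreover have "eventually (\<lambda>P. P \<in> C) (filtermap Q \<F>)"
      using ev by (simp add: eventually_filtermap)
    ultimately have "eventually (\<lambda>_. False) (inf (nhds P) (filtermap Q \<F>))"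
      unfolding eventually_inf by (intro exI conjI) auto
    then show False
      using P by (simp add: trivial_limit_def)
  qed
  then show ?thesis by (rule that)
qed

text \<open>For a distribution function that is not right continuous there is no countably additive solution. For each
finite set \<open>A\<close> of points take the product of discrete distributions whose distribution functions are
correct on \<open>A\<close>; along the directed set of all finite \<open>A\<close> these products have a cluster point among the
functions on the power set, and it is the desired finitely additive product.\<close>

lemma ex_finitely_additive_product:
  fixes F :: "nat \<Rightarrow> ereal \<Rightarrow> real"
  assumes F: "\<And>k. k \<le> n \<Longrightarrow> dist_fun (F k)"
  obtains P :: "(nat \<Rightarrow> ereal) set \<Rightarrow> real" where
    "fin_add_prob UNIV UNIV P"
    "\<And>k x. k \<le> n \<Longrightarrow> P {\<omega>. \<omega> k \<le> x} = F k x"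
    "\<And>I. P {\<omega>. \<forall>k\<in>{0..n}. \<omega> k \<in> I k} = (\<Prod>k\<in>{0..n}. P {\<omega>. \<omega> k \<in> I k})"
proof -
  have "\<forall>A k. \<exists>q. k \<le> n \<longrightarrow> finite A \<longrightarrow> (\<forall>x\<in>A. measure_pmf.prob q {..x} = F k x)"
    using ex_pmf_matching_dist_fun[OF F] by blast
  then obtain q where "\<forall>A k. k \<le> n \<longrightarrow> finite A \<longrightarrow>
      (\<forall>x\<in>A. measure_pmf.prob (q A k) {..x} = F k x)"
    unfolding choice_iff by blast
  then have q: "\<And>k A x. k \<le> n \<Longrightarrow> finite A \<Longrightarrow> x \<in> A \<Longrightarrow>
      measure_pmf.prob (q A k) {..x} = F k x"
    by blast
  define Q :: "ereal set \<Rightarrow> (nat \<Rightarrow> ereal) set \<Rightarrow> real" where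
    "Q = (\<lambda>A. measure_pmf.prob (Pi_pmf {0..n} undefined (q A)))"
  have Q_box: "Q A {\<omega>. \<forall>k\<in>{0..n}. \<omega> k \<in> I k} = (\<Prod>k\<in>{0..n}. measure_pmf.prob (q A k) (I k))" for A I
    using measure_Pi_pmf_Pi[of "{0..n}" undefined "q A" I] unfolding Q_def Pi_def Ball_def by simp
  have Q_coord: "Q A {\<omega>. \<omega> k \<in> B} = measure_pmf.prob (q A k) B" if k: "k \<le> n" for A k B
  proof -
    let ?I = "\<lambda>i. if i = k then B else UNIV"
    have "{\<omega>. \<omega> k \<in> B} = {\<omega>. \<forall>i\<in>{0..n}. \<omega> i \<in> ?I i}"
      using k by auto
    then have "Q A {\<omega>. \<omega> k \<in> B} = (\<Prod>i\<in>{0..n}. measure_pmf.prob (q A i) (?I i))"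
      using Q_box[of A ?I] by simp
    also have "\<dots> = (\<Prod>i\<in>{k}. measure_pmf.prob (q A i) (?I i))"
      using k by (intro prod.mono_neutral_right) auto
    finally show ?thesis by simp
  qed
  have "finite_subsets_at_top (UNIV :: ereal set) \<noteq> bot"
    by simp
  moreover have "Q A E \<in> {0..1}" for A E
    by (simp add: Q_def)
  ultimately obtain P where P: "\<And>C. closed C \<Longrightarrow>
      eventually (\<lambda>A. Q A \<in> C) (finite_subsets_at_top UNIV) \<Longrightarrow> P \<in> C"
    using ex_cluster_function[of "finite_subsets_at_top UNIV" Q] by blast
  have P_eq: "f P = g P"
    if "continuous_on UNIV f" "continuous_on UNIV g"
      and "eventually (\<lambda>A. f (Q A) = g (Q A)) (finite_subsets_at_top UNIV)"
    for f g :: "((nat \<Rightarrow> ereal) set \<Rightarrow> real) \<Rightarrow> real"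
    using P[OF closed_Collect_eq[OF that(1,2)]] that(3) by simp
  have "0 \<le> P E" for E
    using P[OF closed_Collect_le[of "\<lambda>_. 0" "\<lambda>P. P E"]] by (simp add: Q_def)
  moreover have "P UNIV = 1"
    by (rule P_eq) (simp_all add: Q_def)
  moreover have "P (A \<union> B) = P A + P B" if "A \<inter> B = {}" for A B
    by (rule P_eq) (use that in \<open>auto simp: Q_def intro!: continuous_intros measure_pmf.finite_measure_Union\<close>)
  ultimately have "fin_add_prob UNIV UNIV P"
    using algebra_Pow[of UNIV] by (simp add: fin_add_prob_def additive_def)
  moreover have "P {\<omega>. \<omega> k \<le> x} = F k x" if "k \<le> n" for k x
  proof (rule P_eq)
    have "eventually (\<lambda>A. finite A \<and> {x} \<subseteq> A \<and> A \<subseteq> UNIV) (finite_subsets_at_top UNIV)"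
      unfolding eventually_finite_subsets_at_top by (intro exI[of _ "{x}"]) auto
    then show "eventually (\<lambda>A. Q A {\<omega>. \<omega> k \<le> x} = F k x) (finite_subsets_at_top UNIV)"
      by eventually_elim (use q that Q_coord[of k _ "{..x}"] in simp)
  qed simp_all
  moreover have "P {\<omega>. \<forall>k\<in>{0..n}. \<omega> k \<in> I k} = (\<Prod>k\<in>{0..n}. P {\<omega>. \<omega> k \<in> I k})" for I
    by (rule P_eq) (auto simp: Q_box Q_coord intro!: continuous_on_prod)
  ultimately show ?thesis by (rule that)
qed

lemma ex_shock_model:
  assumes F: "\<And>i. i \<in> {1..n} \<Longrightarrow> dist_fun (F i)" and Z: "dist_fun FZ"
  obtains P where "shock_model n (UNIV :: (nat \<Rightarrow> ereal) set) UNIV P (\<lambda>i \<omega>. \<omega> i) (\<lambda>\<omega>. \<omega> 0) F FZ"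
proof -
  have "dist_fun (if k = 0 then FZ else F k)" if "k \<le> n" for k
    using F Z that by auto
  then obtain P :: "(nat \<Rightarrow> ereal) set \<Rightarrow> real" where
    P: "fin_add_prob UNIV UNIV P"
    "\<And>k x. k \<le> n \<Longrightarrow> P {\<omega>. \<omega> k \<le> x} = (if k = 0 then FZ else F k) x"
    "\<And>I. P {\<omega>. \<forall>k\<in>{0..n}. \<omega> k \<in> I k} = (\<Prod>k\<in>{0..n}. P {\<omega>. \<omega> k \<in> I k})"
    using ex_finitely_additive_product[of n "\<lambda>k. if k = 0 then FZ else F k"] by blast
  have "P {\<omega>. (\<forall>i\<in>{1..n}. \<omega> i \<in> I i) \<and> \<omega> 0 \<in> J} =
      (\<Prod>i\<in>{1..n}. P {\<omega>. \<omega> i \<in> I i}) * P {\<omega>. \<omega> 0 \<in> J}" for I J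
  proof -
    let ?I = "\<lambda>k. if k = 0 then J else I k"
    have split: "{0..n} = insert 0 {1..n}" by auto
    have "{\<omega>. (\<forall>i\<in>{1..n}. \<omega> i \<in> I i) \<and> \<omega> 0 \<in> J} = {\<omega>. \<forall>k\<in>{0..n}. \<omega> k \<in> ?I k}"
      unfolding split by auto
    then show ?thesis
      using P(3)[of ?I] unfolding split by (simp add: mult.commute cong: prod.cong_simp)
  qed
  then have "shock_model n UNIV UNIV P (\<lambda>i \<omega>. \<omega> i) (\<lambda>\<omega>. \<omega> 0) F FZ"
    using P(1) P(2)[of 0] P(2)
    by (auto simp: shock_model_def rand_var_def indep_on_intervals_def cdf_of_def fun_eq_iff)
  then show ?thesis by (rule that)
qed

section \<open>Extrema over the box of distribution functions\<close>

text \<open>The infimum and the supremum are attained at the corners \<open>Fl\<close> and \<open>Fu\<close> of the box, which do belong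
to shock models by \<open>ex_shock_model\<close>.\<close>

lemma extremal_G:
  assumes bounds: "\<And>i. i \<in> {1..n} \<Longrightarrow> dist_fun (Fl i) \<and> dist_fun (Fu i) \<and> Fl i \<le> Fu i"
    and Z: "dist_fun FZ" and i: "i \<in> {1..n}"
  shows "lower_G n p Fl Fu FZ i x = shock_margin p i (Fl i x) (FZ x)"
    and "upper_G n p Fl Fu FZ i x = shock_margin p i (Fu i x) (FZ x)"
proof -
  have rangeZ: "FZ x \<in> {0..1}"
    using Z by (auto simp: dist_fun_def)
  have attained: "shock_margin p i (F i x) (FZ x) \<in> G_values n p Fl Fu FZ i x"
    if F: "\<And>k. k \<in> {1..n} \<Longrightarrow> F k \<in> dist_box (Fl k) (Fu k)" for F
  proof -
    have dist: "dist_fun (F k)" if "k \<in> {1..n}" for k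
      using F[OF that] by (simp add: dist_box_def)
    obtain P where model:
      "shock_model n (UNIV :: (nat \<Rightarrow> ereal) set) UNIV P (\<lambda>i \<omega>. \<omega> i) (\<lambda>\<omega>. \<omega> 0) F FZ"
      using ex_shock_model[of n F FZ] dist Z by blast
    interpret shock_model_space n p "UNIV :: (nat \<Rightarrow> ereal) set" UNIV P "\<lambda>i \<omega>. \<omega> i" "\<lambda>\<omega>. \<omega> 0" F FZ
      using model dist Z by unfold_locales
    show ?thesis
      unfolding G_values_def shock_G_eq[OF i, of x, symmetric] using model F by blast
  qed
  have between: "v \<in> {shock_margin p i (Fl i x) (FZ x)..shock_margin p i (Fu i x) (FZ x)}"
    if v: "v \<in> G_values n p Fl Fu FZ i x" for v
  proof -
    obtain \<Omega> :: "(nat \<Rightarrow> ereal) set" and M P X Z F where v: "v = shock_G p \<Omega> P X Z i x"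
      and F: "\<forall>k\<in>{1..n}. F k \<in> dist_box (Fl k) (Fu k)" and model: "shock_model n \<Omega> M P X Z F FZ"
      using v unfolding G_values_def by blast
    interpret shock_model_space n p \<Omega> M P X Z F FZ
      using model F Z by unfold_locales (auto simp: dist_box_def)
    have "Fl i x \<le> F i x" "F i x \<le> Fu i x"
      using F i by (auto simp: dist_box_def le_fun_def)
    then show ?thesis
      using shock_G_eq[OF i, of x] shock_margin_mono[OF _ rangeZ] by (simp add: v)
  qed
  show "lower_G n p Fl Fu FZ i x = shock_margin p i (Fl i x) (FZ x)"
    unfolding lower_G_def
    by (rule cInf_eq_minimum) (use bounds attained[of Fl] between in \<open>auto simp: dist_box_def\<close>)
  show "upper_G n p Fl Fu FZ i x = shock_margin p i (Fu i x) (FZ x)"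
    unfolding upper_G_def
    by (rule cSup_eq_maximum) (use bounds attained[of Fu] between in \<open>auto simp: dist_box_def\<close>)
qed

text \<open>The joint distribution depends monotonically on the values of all \<open>F i\<close>, so its extrema are again
attained at the corners of the box.\<close>

lemma extremal_H:
  assumes p: "1 \<le> p" "p < n"
    and bounds: "\<And>i. i \<in> {1..n} \<Longrightarrow> dist_fun (Fl i) \<and> dist_fun (Fu i) \<and> Fl i \<le> Fu i"
    and Z: "dist_fun FZ"
  defines "\<Phi> \<equiv> \<lambda>F x. shock_formula {1..p} {p+1..n} (\<lambda>i. F i (x i)) (\<lambda>i. FZ (x i))"
  shows "lower_H n p Fl Fu FZ x \<in> H_values n p Fl Fu FZ x" "lower_H n p Fl Fu FZ x = \<Phi> Fl x"
    and "upper_H n p Fl Fu FZ x \<in> H_values n p Fl Fu FZ x" "upper_H n p Fl Fu FZ x = \<Phi> Fu x"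
proof -
  have attained: "\<Phi> F x \<in> H_values n p Fl Fu FZ x"
    if F: "\<And>k. k \<in> {1..n} \<Longrightarrow> F k \<in> dist_box (Fl k) (Fu k)" for F
  proof -
    have dist: "dist_fun (F k)" if "k \<in> {1..n}" for k
      using F[OF that] by (simp add: dist_box_def)
    obtain P where model:
      "shock_model n (UNIV :: (nat \<Rightarrow> ereal) set) UNIV P (\<lambda>i \<omega>. \<omega> i) (\<lambda>\<omega>. \<omega> 0) F FZ"
      using ex_shock_model[of n F FZ] dist Z by blast
    interpret shock_model_space n p "UNIV :: (nat \<Rightarrow> ereal) set" UNIV P "\<lambda>i \<omega>. \<omega> i" "\<lambda>\<omega>. \<omega> 0" F FZ
      using model dist Z by unfold_locales
    show ?thesis
      unfolding \<Phi>_def H_values_def shock_H_eq_formula[OF p, of x, symmetric] using model F by blast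
  qed
  have between: "\<Phi> Fl x \<le> v \<and> v \<le> \<Phi> Fu x" if v: "v \<in> H_values n p Fl Fu FZ x" for v
  proof -
    obtain \<Omega> :: "(nat \<Rightarrow> ereal) set" and M P X Z F where v: "v = shock_H n p \<Omega> P X Z x"
      and F: "\<forall>k\<in>{1..n}. F k \<in> dist_box (Fl k) (Fu k)" and model: "shock_model n \<Omega> M P X Z F FZ"
      using v unfolding H_values_def by blast
    interpret shock_model_space n p \<Omega> M P X Z F FZ
      using model F Z by unfold_locales (auto simp: dist_box_def)
    have "0 \<le> Fl i (x i) \<and> Fl i (x i) \<le> F i (x i) \<and> F i (x i) \<le> Fu i (x i)"
      if "i \<in> {1..p} \<union> {p+1..n}" for i
    proof -
      have "i \<in> {1..n}" using that p by auto
      then have "dist_fun (Fl i)" "F i \<in> dist_box (Fl i) (Fu i)"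
        using F bounds by blast+
      then show ?thesis by (auto simp: dist_fun_def dist_box_def le_fun_def Pi_iff)
    qed
    then show ?thesis
      unfolding v shock_H_eq_formula[OF p] \<Phi>_def
      by (intro conjI shock_formula_mono) (meson order_trans)+
  qed
  have Fl: "\<Phi> Fl x \<in> H_values n p Fl Fu FZ x" and Fu: "\<Phi> Fu x \<in> H_values n p Fl Fu FZ x"
    by (rule attained, use bounds in \<open>auto simp: dist_box_def\<close>)+
  show "lower_H n p Fl Fu FZ x = \<Phi> Fl x"
    unfolding lower_H_def by (rule cInf_eq_minimum) (use Fl between in auto)
  then show "lower_H n p Fl Fu FZ x \<in> H_values n p Fl Fu FZ x"
    using Fl by simp
  show "upper_H n p Fl Fu FZ x = \<Phi> Fu x"
    unfolding upper_H_def by (rule cSup_eq_maximum) (use Fu between in auto)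
  then show "upper_H n p Fl Fu FZ x \<in> H_values n p Fl Fu FZ x"
    using Fu by simp
qed

text \<open>An identity between real numbers, obtained by realising \<open>F\<close> and \<open>FZ\<close> in a shock model: it is not
evident from the formulas when some of the values are degenerate.\<close>

lemma shock_formula_eq_C_MM:
  assumes p: "1 \<le> p" "p < n"
    and F: "\<And>i. i \<in> {1..n} \<Longrightarrow> dist_fun (F i)" and Z: "dist_fun FZ"
    and G: "\<And>i x. i \<in> {1..n} \<Longrightarrow> G i x = shock_margin p i (F i x) (FZ x)"
    and ends: "\<And>i. i \<in> {1..n} \<Longrightarrow> \<phi> i 0 = 0 \<and> \<phi> i 1 = 1"
    and interp: "\<And>i x. i \<in> {1..n} \<Longrightarrow> nondegenerate p i (G i x) \<Longrightarrow> \<phi> i (G i x) = F i x"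
  shows "shock_formula {1..p} {p+1..n} (\<lambda>i. F i (x i)) (\<lambda>i. FZ (x i)) =
    C_MM n p \<phi> (\<lambda>i. G i (x i))"
proof -
  obtain P where model:
    "shock_model n (UNIV :: (nat \<Rightarrow> ereal) set) UNIV P (\<lambda>i \<omega>. \<omega> i) (\<lambda>\<omega>. \<omega> 0) F FZ"
    using ex_shock_model[of n F FZ] F Z by blast
  interpret shock_model_space n p "UNIV :: (nat \<Rightarrow> ereal) set" UNIV P "\<lambda>i \<omega>. \<omega> i" "\<lambda>\<omega>. \<omega> 0" F FZ
    using model F Z by unfold_locales
  show ?thesis
    using shock_H_eq_formula[OF p] shock_H_eq_C_MM[OF p G ends interp] by simp
qed

section \<open>The two kinds of generating functions\<close>

text \<open>The conditions (F1)--(F3) for a component with index \<open>\<le> p\<close>, in a form free of division: \<open>f u / u\<close> is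
decreasing. That \<open>f\<close> does not vanish on the positive numbers and that the dagger is at most \<open>1\<close> is
the instance \<open>v = 1\<close> of the last condition, which reads \<open>u \<le> f u\<close>.\<close>

definition max_generator :: "(real \<Rightarrow> real) \<Rightarrow> bool" where
  "max_generator f \<longleftrightarrow>
     f \<in> {0..1} \<rightarrow> {0..1} \<and> f 0 = 0 \<and> f 1 = 1 \<and> mono_on {0..1} f \<and>
     (\<forall>u v. 0 < u \<longrightarrow> u \<le> v \<longrightarrow> v \<le> 1 \<longrightarrow> f v * u \<le> f u * v)"

lemma max_generator_star:
  assumes "max_generator f" "0 < u" "u \<le> v" "v \<le> 1"
  shows "f v * u \<le> f u * v"
  using assms by (simp add: max_generator_def)

lemma max_generator_ge_id:
  assumes "max_generator f" "u \<in> {0..1}"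
  shows "u \<le> f u"
proof (cases "u = 0")
  case False
  then have "f 1 * u \<le> f u * 1"
    using assms(2) by (intro max_generator_star[OF assms(1)]) auto
  then show ?thesis
    using assms(1) by (simp add: max_generator_def)
qed (use assms in \<open>auto simp: max_generator_def\<close>)

lemma generating_max_iff:
  assumes "i \<le> p"
  shows "generating p i f \<longleftrightarrow> max_generator f"
proof
  assume gen: "generating p i f"
  then have range: "f \<in> {0..1} \<rightarrow> {0..1}" and pos: "\<forall>u\<in>{0<..1}. f u \<noteq> 0"
    and mono: "mono_on {0<..1} (dagger p i f)"
    using assms by (auto simp: generating_def)
  have "f v * u \<le> f u * v" if "0 < u" "u \<le> v" "v \<le> 1" for u v
  proof -
    have "0 < f u" "0 < f v"
      using range pos that by (auto simp: Pi_iff order.order_iff_strict)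
    moreover have "u / f u \<le> v / f v"
      using mono_onD[OF mono, of u v] that assms by (auto simp: dagger_def)
    ultimately show ?thesis
      by (simp add: divide_simps mult.commute)
  qed
  then show "max_generator f"
    using gen by (auto simp: generating_def max_generator_def)
next
  assume f: "max_generator f"
  have ge: "u \<le> f u" if "0 < u" "u \<le> 1" for u
    using max_generator_ge_id[OF f] that by auto
  have "dagger p i f u \<le> dagger p i f v" if "0 < u" "u \<le> v" "v \<le> 1" for u v
  proof -
    have "0 < f u" "0 < f v" "f v * u \<le> f u * v"
      using ge[of u] ge[of v] that max_generator_star[OF f] by auto
    then show ?thesis
      using that assms by (simp add: dagger_def divide_simps mult.commute)
  qed
  moreover have "dagger p i f u \<in> {0..1}" if "0 < u" "u \<le> 1" for u
    using ge[of u] that assms by (simp add: dagger_def divide_simps)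
  moreover have "f u \<noteq> 0" if "0 < u" "u \<le> 1" for u
    using ge[of u] that by auto
  ultimately show "generating p i f"
    using f assms unfolding generating_def max_generator_def by (auto simp: mono_on_def)
qed

text \<open>The point reflection of the unit square exchanges the two kinds of generating functions, just as
\<open>min X Z\<close> becomes \<open>max (- X) (- Z)\<close> under a change of sign. It reverses the pointwise order, so it
exchanges least and greatest generators.\<close>

definition reflect :: "(real \<Rightarrow> real) \<Rightarrow> real \<Rightarrow> real" where
  "reflect f w = 1 - f (1 - w)"

lemma reflect_reflect [simp]: "reflect (reflect f) = f"
  by (auto simp: reflect_def)

lemma dagger_min_eq:
  assumes "p < j" "u < 1" "f u \<noteq> 1"
  shows "dagger p j f u = 1 - (1 - u) / reflect f (1 - u)"
  using assms by (simp add: dagger_def reflect_def field_simps)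

lemma generating_min_iff:
  assumes "p < j"
  shows "generating p j f \<longleftrightarrow> max_generator (reflect f)"
proof
  assume gen: "generating p j f"
  then have range: "f \<in> {0..1} \<rightarrow> {0..1}" and pos: "\<forall>u\<in>{0..<1}. f u \<noteq> 1"
    and mono: "mono_on {0..<1} (dagger p j f)"
    and monof: "mono_on {0..1} f"
    using assms by (auto simp: generating_def)
  have "reflect f v * u \<le> reflect f u * v" if "0 < u" "u \<le> v" "v \<le> 1" for u v
  proof -
    have "f (1 - u) < 1" "f (1 - v) < 1"
      using range pos that by (auto simp: Pi_iff order.order_iff_strict)
    then have "0 < reflect f u" "0 < reflect f v" "f (1 - u) \<noteq> 1" "f (1 - v) \<noteq> 1"
      by (auto simp: reflect_def)
    moreover from this have "u / reflect f u \<le> v / reflect f v"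
      using mono_onD[OF mono, of "1 - v" "1 - u"] that assms by (simp add: dagger_min_eq)
    ultimately show ?thesis
      by (simp add: divide_simps mult.commute)
  qed
  moreover have "reflect f \<in> {0..1} \<rightarrow> {0..1}"
    using range by (auto simp: reflect_def Pi_iff)
  moreover have "mono_on {0..1} (reflect f)"
    using monof by (auto simp: mono_on_def reflect_def)
  ultimately show "max_generator (reflect f)"
    using gen by (auto simp: generating_def max_generator_def reflect_def)
next
  assume f: "max_generator (reflect f)"
  have ge: "f u \<le> u" if "0 \<le> u" "u < 1" for u
    using max_generator_ge_id[OF f, of "1 - u"] that by (auto simp: reflect_def)
  have range: "reflect f \<in> {0..1} \<rightarrow> {0..1}" and mono: "mono_on {0..1} (reflect f)"
    using f by (auto simp: max_generator_def)
  have range': "f u \<in> {0..1}" if "u \<in> {0..1}" for u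
    using range that by (auto simp: reflect_def Pi_iff dest!: bspec[of _ _ "1 - u"])
  have mono': "f u \<le> f v" if "0 \<le> u" "u \<le> v" "v \<le> 1" for u v
    using mono_onD[OF mono, of "1 - v" "1 - u"] that by (auto simp: reflect_def)
  have "dagger p j f u \<le> dagger p j f v" if "0 \<le> u" "u \<le> v" "v < 1" for u v
  proof -
    have "0 < reflect f (1 - u)" "0 < reflect f (1 - v)"
      "reflect f (1 - u) * (1 - v) \<le> reflect f (1 - v) * (1 - u)" "f u \<noteq> 1" "f v \<noteq> 1"
      using ge[of u] ge[of v] that max_generator_star[OF f, of "1 - v" "1 - u"]
      by (auto simp: reflect_def)
    moreover from this have "(1 - v) / reflect f (1 - v) \<le> (1 - u) / reflect f (1 - u)"
      by (simp add: divide_simps mult.commute)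
    ultimately show ?thesis
      using that assms by (simp add: dagger_min_eq)
  qed
  moreover have "dagger p j f u \<in> {0..1}" if "0 \<le> u" "u < 1" for u
    using ge[of u] range'[of u] that assms by (auto simp: dagger_def divide_simps)
  moreover have "f u \<noteq> 1" if "0 \<le> u" "u < 1" for u
    using ge[of u] that by auto
  moreover have "f 0 = 0" "f 1 = 1"
    using f by (auto simp: max_generator_def reflect_def)
  ultimately show "generating p j f"
    using range' mono' assms unfolding generating_def by (auto simp: mono_on_def)
qed

section \<open>Least and greatest generators\<close>

text \<open>Generators of the first kind that send the product \<open>F x * Z x\<close> to its first factor. No order on
the points \<open>x\<close> is involved, so that the decreasing functions \<open>1 - F\<close> and \<open>1 - FZ\<close> can take the places
of \<open>F\<close> and \<open>Z\<close>.\<close>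

definition interpolants :: "('b \<Rightarrow> real) \<Rightarrow> ('b \<Rightarrow> real) \<Rightarrow> (real \<Rightarrow> real) set" where
  "interpolants F Z =
     {f. max_generator f \<and> (\<forall>x. 0 < F x * Z x \<longrightarrow> f (F x * Z x) = F x)}"

lemma compatible_max_iff:
  assumes "i \<le> p" "\<And>x. G x = F x * Z x"
  shows "f \<in> compatible_generators p i G F \<longleftrightarrow> f \<in> interpolants F Z"
  using assms by (simp add: compatible_generators_def interpolants_def generating_max_iff)

lemma compatible_min_iff:
  assumes "p < j" "\<And>x. 1 - G x = (1 - F x) * (1 - Z x)"
  shows "f \<in> compatible_generators p j G F \<longleftrightarrow>
         reflect f \<in> interpolants (\<lambda>x. 1 - F x) (\<lambda>x. 1 - Z x)"
  using assms(1)
  by (simp add: compatible_generators_def interpolants_def generating_min_iff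
      assms(2)[symmetric] reflect_def)

text \<open>What a pair of distribution functions \<open>(F, FZ)\<close> has in common with the pair \<open>(1 - F, 1 - FZ)\<close> of
decreasing functions: both components vary in the same direction, and they reach \<open>1\<close> simultaneously.\<close>

definition comonotone_pair :: "('b \<Rightarrow> real) \<Rightarrow> ('b \<Rightarrow> real) \<Rightarrow> bool" where
  "comonotone_pair F Z \<longleftrightarrow>
     (\<forall>x. F x \<in> {0..1} \<and> Z x \<in> {0..1}) \<and>
     (\<forall>x y. F x \<le> F y \<or> Z y \<le> Z x) \<and> (\<exists>x. F x = 1 \<and> Z x = 1)"

lemma comonotone_pair_dist_fun:
  assumes "dist_fun F" "dist_fun Z"
  shows "comonotone_pair F Z" "comonotone_pair (\<lambda>x. 1 - F x) (\<lambda>x. 1 - Z x)"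
proof -
  have range: "F x \<in> {0..1}" "Z x \<in> {0..1}" for x
    using assms by (auto simp: dist_fun_def)
  have "F x \<le> F y \<or> Z y \<le> Z x" for x y
    using assms by (cases "x \<le> y") (auto simp: dist_fun_def mono_def)
  moreover have "F \<infinity> = 1" "Z \<infinity> = 1" "F (-\<infinity>) = 0" "Z (-\<infinity>) = 0"
    using assms by (auto simp: dist_fun_def)
  ultimately show "comonotone_pair F Z" "comonotone_pair (\<lambda>x. 1 - F x) (\<lambda>x. 1 - Z x)"
    using range unfolding comonotone_pair_def by (force, fastforce)
qed

text \<open>Let \<open>g\<close> be increasing with \<open>g u / u\<close> decreasing and \<open>g (F x * Z x) = F x\<close>. To the right of the node
\<open>F x * Z x\<close> monotonicity bounds \<open>g\<close> from below by \<open>F x\<close> and the decreasing quotient bounds it from above by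
\<open>u / Z x\<close>; to the left of the node the two bounds change roles. Since \<open>F x \<le> u / Z x\<close> exactly to the right
of the node, the lower bound is \<open>min (F x) (u / Z x)\<close> and the upper bound \<open>max (F x) (u / Z x)\<close>
throughout. The envelopes combine these bounds over all nodes. The value \<open>0\<close> of the upper one at \<open>0\<close>
is set separately, because the infimum of the \<open>F x\<close> may be positive.\<close>

definition lower_envelope :: "('b \<Rightarrow> real) \<Rightarrow> ('b \<Rightarrow> real) \<Rightarrow> real \<Rightarrow> real" where
  "lower_envelope F Z u = (SUP x\<in>{x. 0 < F x * Z x}. min (F x) (u / Z x))"

definition upper_envelope :: "('b \<Rightarrow> real) \<Rightarrow> ('b \<Rightarrow> real) \<Rightarrow> real \<Rightarrow> real" where
  "upper_envelope F Z u =
     (if u = 0 then 0 else INF x\<in>{x. 0 < F x * Z x}. max (F x) (u / Z x))"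

context
  fixes F Z :: "'b \<Rightarrow> real"
  assumes pair: "comonotone_pair F Z"
begin

lemma pair_pos:
  assumes "0 < F x * Z x"
  shows "0 < F x" "F x \<le> 1" "0 < Z x" "Z x \<le> 1"
  using assms pair by (auto simp: comonotone_pair_def zero_less_mult_iff)
    (metis atLeastAtMost_iff not_less)+

lemma pair_top: obtains x0 where "F x0 = 1" "Z x0 = 1" "0 < F x0 * Z x0"
  using pair by (auto simp: comonotone_pair_def)

lemma pair_support_nonempty: "{x. 0 < F x * Z x} \<noteq> {}"
  by (rule pair_top) blast

lemma lower_envelope_upper:
  assumes "0 < F x * Z x"
  shows "min (F x) (u / Z x) \<le> lower_envelope F Z u"
  unfolding lower_envelope_def
  by (rule cSUP_upper) (use assms pair in \<open>auto simp: comonotone_pair_def intro!: bdd_aboveI[of _ 1] min.coboundedI1\<close>)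

lemma lower_envelope_least:
  assumes "\<And>x. 0 < F x * Z x \<Longrightarrow> min (F x) (u / Z x) \<le> c"
  shows "lower_envelope F Z u \<le> c"
  unfolding lower_envelope_def
  by (rule cSUP_least[OF pair_support_nonempty]) (use assms in auto)

lemma upper_envelope_lower:
  assumes "0 < F x * Z x" "0 < u"
  shows "upper_envelope F Z u \<le> max (F x) (u / Z x)"
proof -
  have "bdd_below ((\<lambda>x. max (F x) (u / Z x)) ` {x. 0 < F x * Z x})"
    using pair_pos by (auto intro!: bdd_belowI[of _ 0] simp: le_max_iff_disj less_imp_le)
  then show ?thesis
    unfolding upper_envelope_def using assms by (auto intro!: cINF_lower)
qed

lemma upper_envelope_greatest:
  assumes "\<And>x. 0 < F x * Z x \<Longrightarrow> c \<le> max (F x) (u / Z x)" "0 < u"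
  shows "c \<le> upper_envelope F Z u"
  unfolding upper_envelope_def using assms(2)
  using cINF_greatest[OF pair_support_nonempty, of c "\<lambda>x. max (F x) (u / Z x)"] assms(1) by auto

text \<open>Comonotonicity makes the bounds coming from different nodes compatible: at the node of \<open>y\<close> the bound
coming from \<open>x\<close> is at most \<open>F y\<close>, either because \<open>F x \<le> F y\<close> or because \<open>Z y \<le> Z x\<close>. The same two cases
with \<open>x\<close> and \<open>y\<close> exchanged serve for the upper envelope.\<close>

lemma lower_envelope_interpolates:
  assumes "0 < F y * Z y"
  shows "lower_envelope F Z (F y * Z y) = F y"
proof (rule antisym)
  show "lower_envelope F Z (F y * Z y) \<le> F y"
  proof (rule lower_envelope_least)
    fix x assume x: "0 < F x * Z x"
    have "F y * Z y / Z x \<le> F y" if "Z y \<le> Z x"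
      using that pair_pos[OF x] pair_pos[OF assms] by (simp add: divide_simps)
    then show "min (F x) (F y * Z y / Z x) \<le> F y"
      using pair unfolding comonotone_pair_def by (metis min.coboundedI1 min.coboundedI2)
  qed
  show "F y \<le> lower_envelope F Z (F y * Z y)"
    using lower_envelope_upper[OF assms, of "F y * Z y"] pair_pos[OF assms] by simp
qed

lemma upper_envelope_interpolates:
  assumes "0 < F y * Z y"
  shows "upper_envelope F Z (F y * Z y) = F y"
proof (rule antisym)
  show "F y \<le> upper_envelope F Z (F y * Z y)"
  proof (rule upper_envelope_greatest[OF _ assms])
    fix x assume x: "0 < F x * Z x"
    have "F y \<le> F y * Z y / Z x" if "Z x \<le> Z y"
      using that pair_pos[OF x] pair_pos[OF assms] by (simp add: divide_simps)
    then show "F y \<le> max (F x) (F y * Z y / Z x)"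
      using pair unfolding comonotone_pair_def by (metis max.coboundedI1 max.coboundedI2)
  qed
  show "upper_envelope F Z (F y * Z y) \<le> F y"
    using upper_envelope_lower[OF assms assms] pair_pos[OF assms] by simp
qed

text \<open>The functions \<open>min (F x) (u / Z x)\<close> and \<open>max (F x) (u / Z x)\<close> of \<open>u\<close> increase while their quotients by
\<open>u\<close> decrease, and both properties survive suprema and infima. The common point where \<open>F\<close> and \<open>Z\<close> are \<open>1\<close>
ensures the value \<open>1\<close> at \<open>1\<close>.\<close>

lemma lower_envelope_max_generator: "max_generator (lower_envelope F Z)"
proof -
  obtain x0 where x0: "F x0 = 1" "Z x0 = 1" "0 < F x0 * Z x0"
    using pair_top by auto
  have ge: "min 1 u \<le> lower_envelope F Z u" for u
    using lower_envelope_upper[OF x0(3), of u] x0 by simp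
  have le: "lower_envelope F Z u \<le> 1" for u
    by (rule lower_envelope_least) (use pair_pos in \<open>auto simp: min_le_iff_disj\<close>)
  have zero: "lower_envelope F Z 0 = 0"
    using ge[of 0] pair_pos by (intro antisym lower_envelope_least) (auto simp: min_le_iff_disj)
  have one: "lower_envelope F Z 1 = 1"
    using ge[of 1] le[of 1] by simp
  have mono: "lower_envelope F Z u \<le> lower_envelope F Z v" if "u \<le> v" for u v
  proof (rule lower_envelope_least)
    fix x assume x: "0 < F x * Z x"
    have "min (F x) (u / Z x) \<le> min (F x) (v / Z x)"
      using that pair_pos[OF x] by (intro min.mono divide_right_mono) auto
    also have "\<dots> \<le> lower_envelope F Z v"
      by (rule lower_envelope_upper[OF x])
    finally show "min (F x) (u / Z x) \<le> lower_envelope F Z v" .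
  qed
  have "lower_envelope F Z v * u \<le> lower_envelope F Z u * v" if "0 < u" "u \<le> v" for u v
  proof -
    have "lower_envelope F Z v \<le> lower_envelope F Z u * v / u"
    proof (rule lower_envelope_least)
      fix x assume x: "0 < F x * Z x"
      have "F x * u \<le> F x * v"
        using that pair_pos[OF x] by (intro mult_left_mono) auto
      then have "min (F x) (v / Z x) \<le> min (F x) (u / Z x) * v / u"
        using that pair_pos[OF x] by (auto simp: min_def divide_simps mult.commute)
      also have "\<dots> \<le> lower_envelope F Z u * v / u"
        using that lower_envelope_upper[OF x, of u] by (intro divide_right_mono mult_right_mono) auto
      finally show "min (F x) (v / Z x) \<le> lower_envelope F Z u * v / u" .
    qed
    then show ?thesis
      using that by (simp add: divide_simps)
  qed
  moreover have "0 \<le> lower_envelope F Z u" if "0 \<le> u" for u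
    using mono[OF that] zero by simp
  ultimately show ?thesis
    using le zero one mono by (auto simp: max_generator_def mono_on_def)
qed

lemma upper_envelope_max_generator: "max_generator (upper_envelope F Z)"
proof -
  obtain x0 where x0: "F x0 = 1" "Z x0 = 1" "0 < F x0 * Z x0"
    using pair_top by auto
  have le: "upper_envelope F Z u \<le> 1" if "u \<in> {0..1}" for u
    using upper_envelope_lower[OF x0(3), of u] x0 that
    by (cases "u = 0") (auto simp: upper_envelope_def)
  have one: "upper_envelope F Z 1 = 1"
    by (intro antisym le upper_envelope_greatest)
      (use pair_pos in \<open>auto simp: le_max_iff_disj\<close>)
  have nonneg: "0 \<le> upper_envelope F Z u" if "0 \<le> u" for u
  proof (cases "u = 0")
    case False
    then show ?thesis
      using that pair_pos
      by (intro upper_envelope_greatest) (auto simp: le_max_iff_disj less_imp_le)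
  qed (simp add: upper_envelope_def)
  have mono: "upper_envelope F Z u \<le> upper_envelope F Z v" if "0 < u" "u \<le> v" for u v
  proof (rule upper_envelope_greatest)
    fix x assume x: "0 < F x * Z x"
    have "upper_envelope F Z u \<le> max (F x) (u / Z x)"
      by (rule upper_envelope_lower[OF x that(1)])
    also have "\<dots> \<le> max (F x) (v / Z x)"
      using that pair_pos[OF x] by (intro max.mono divide_right_mono) auto
    finally show "upper_envelope F Z u \<le> max (F x) (v / Z x)" .
  qed (use that in simp)
  have "upper_envelope F Z v * u \<le> upper_envelope F Z u * v" if "0 < u" "u \<le> v" for u v
  proof -
    have "upper_envelope F Z v * u / v \<le> upper_envelope F Z u"
    proof (rule upper_envelope_greatest)
      fix x assume x: "0 < F x * Z x"
      have "F x * u \<le> F x * v"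
        using that pair_pos[OF x] by (intro mult_left_mono) auto
      then have *: "max (F x) (v / Z x) * u / v \<le> max (F x) (u / Z x)"
        using that pair_pos[OF x] by (auto simp: max_def divide_simps mult.commute)
      have "upper_envelope F Z v * u / v \<le> max (F x) (v / Z x) * u / v"
        using that upper_envelope_lower[OF x, of v] by (intro divide_right_mono mult_right_mono) auto
      then show "upper_envelope F Z v * u / v \<le> max (F x) (u / Z x)"
        using * by simp
    qed (use that in simp)
    then show ?thesis
      using that by (simp add: divide_simps)
  qed
  moreover have "upper_envelope F Z u \<le> upper_envelope F Z v" if "0 \<le> u" "u \<le> v" for u v
    using mono[of u v] nonneg[of v] that by (cases "u = 0") (auto simp: upper_envelope_def)
  ultimately show ?thesis
    using le one nonneg by (auto simp: max_generator_def mono_on_def upper_envelope_def)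
qed

lemma lower_envelope_interpolant: "lower_envelope F Z \<in> interpolants F Z"
  using lower_envelope_max_generator lower_envelope_interpolates by (simp add: interpolants_def)

lemma upper_envelope_interpolant: "upper_envelope F Z \<in> interpolants F Z"
  using upper_envelope_max_generator upper_envelope_interpolates by (simp add: interpolants_def)

lemma interpolant_between_envelopes:
  assumes "g \<in> interpolants F Z" "u \<in> {0..1}"
  shows "lower_envelope F Z u \<le> g u" "g u \<le> upper_envelope F Z u"
proof -
  have mono: "mono_on {0..1} g"
    and star: "\<And>u v. 0 < u \<Longrightarrow> u \<le> v \<Longrightarrow> v \<le> 1 \<Longrightarrow> g v * u \<le> g u * v"
    and interp: "\<And>x. 0 < F x * Z x \<Longrightarrow> g (F x * Z x) = F x"
    and zero: "g 0 = 0"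
    using assms(1) by (auto simp: interpolants_def max_generator_def)
  have "min (F x) (u / Z x) \<le> g u \<and> (0 < u \<longrightarrow> g u \<le> max (F x) (u / Z x))"
    if x: "0 < F x * Z x" for x
  proof -
    have G: "F x * Z x \<le> 1"
      using pair_pos[OF x] by (simp add: mult_le_one)
    show ?thesis
    proof (cases "F x * Z x \<le> u")
      case True
      have "F x \<le> g u"
        using mono_onD[OF mono, of "F x * Z x" u] True x G assms(2) interp[OF x] by simp
      moreover have "g u * (F x * Z x) \<le> F x * u"
        using star[OF x True] assms(2) interp[OF x] by simp
      then have "g u \<le> u / Z x"
        using pair_pos[OF x] by (simp add: divide_simps mult.commute mult.left_commute)
      ultimately show ?thesis by auto
    next
      case False
      then have "g u \<le> F x"
        using mono_onD[OF mono, of u "F x * Z x"] x G assms(2) interp[OF x] by simp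
      moreover have "u / Z x \<le> g u"
      proof (cases "u = 0")
        case neq: False
        then have "F x * u \<le> g u * (F x * Z x)"
          using star[of u "F x * Z x"] False G assms(2) interp[OF x] by simp
        then show ?thesis
          using pair_pos[OF x] by (simp add: divide_simps mult.commute mult.left_commute)
      qed (use zero in simp)
      ultimately show ?thesis by auto
    qed
  qed
  then show "lower_envelope F Z u \<le> g u" "g u \<le> upper_envelope F Z u"
    using assms(2) zero lower_envelope_least[of u "g u"] upper_envelope_greatest[of "g u" u]
    by (cases "u = 0"; auto simp: upper_envelope_def)+
qed

end

text \<open>The two families of bounds can be compared one by one, for different distribution functions \<open>F \<le> F'\<close>
and the same \<open>Z\<close>: if \<open>F x > F' y\<close> then \<open>F x > F y\<close>, whence \<open>Z y \<le> Z x\<close>. This makes the least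
generator for \<open>F\<close> lie below the greatest one for \<open>F'\<close>.\<close>

lemma lower_envelope_le_upper_envelope:
  assumes pairs: "comonotone_pair F Z" "comonotone_pair F' Z" and le: "\<And>x. F x \<le> F' x"
    and u: "u \<in> {0..1}"
  shows "lower_envelope F Z u \<le> upper_envelope F' Z u"
proof (cases "u = 0")
  case True
  then show ?thesis
    using lower_envelope_max_generator[OF pairs(1)] by (simp add: max_generator_def upper_envelope_def)
next
  case False
  then have "0 < u" using u by simp
  show ?thesis
  proof (rule lower_envelope_least[OF pairs(1)], rule upper_envelope_greatest[OF pairs(2) _ \<open>0 < u\<close>])
    fix x y assume x: "0 < F x * Z x" and y: "0 < F' y * Z y"
    have "F x \<le> F' y \<or> Z y \<le> Z x"
      using pairs(1) le[of y] unfolding comonotone_pair_def by (meson order_trans)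
    moreover have "u / Z x \<le> u / Z y" if "Z y \<le> Z x"
      using that pair_pos[OF pairs(2) y] \<open>0 < u\<close> by (intro divide_left_mono) auto
    ultimately show "min (F x) (u / Z x) \<le> max (F' y) (u / Z y)"
      by (auto simp: min_le_iff_disj le_max_iff_disj)
  qed
qed

lemma least_generatorI:
  assumes "f \<in> A" "\<And>g u. g \<in> A \<Longrightarrow> u \<in> {0..1} \<Longrightarrow> f u \<le> g u"
  shows "least_generator A \<in> A" "u \<in> {0..1} \<Longrightarrow> least_generator A u \<le> f u"
proof -
  have "least_generator A \<in> A \<and> (\<forall>g\<in>A. \<forall>u\<in>{0..1}. least_generator A u \<le> g u)"
    unfolding least_generator_def by (rule someI[of _ f]) (use assms in auto)
  then show "least_generator A \<in> A" "u \<in> {0..1} \<Longrightarrow> least_generator A u \<le> f u"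
    using assms(1) by auto
qed

lemma greatest_generatorI:
  assumes "f \<in> A" "\<And>g u. g \<in> A \<Longrightarrow> u \<in> {0..1} \<Longrightarrow> g u \<le> f u"
  shows "greatest_generator A \<in> A" "u \<in> {0..1} \<Longrightarrow> f u \<le> greatest_generator A u"
proof -
  have "greatest_generator A \<in> A \<and> (\<forall>g\<in>A. \<forall>u\<in>{0..1}. g u \<le> greatest_generator A u)"
    unfolding greatest_generator_def by (rule someI[of _ f]) (use assms in auto)
  then show "greatest_generator A \<in> A" "u \<in> {0..1} \<Longrightarrow> f u \<le> greatest_generator A u"
    using assms(1) by auto
qed

text \<open>For \<open>i \<le> p\<close> the two envelopes are the extremal generators. For \<open>i > p\<close> they are applied to the
reflected data \<open>1 - F\<close>, \<open>1 - Z\<close>, with the roles of least and greatest exchanged.\<close>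

lemma extremal_generators:
  assumes "dist_fun F" "dist_fun F'" "dist_fun Z" "F \<le> F'"
    and G: "\<And>x. G x = shock_margin p i (F x) (Z x)" "\<And>x. G' x = shock_margin p i (F' x) (Z x)"
  shows "least_generator (compatible_generators p i G F) \<in> compatible_generators p i G F"
    and "greatest_generator (compatible_generators p i G' F') \<in> compatible_generators p i G' F'"
    and "u \<in> {0..1} \<Longrightarrow> least_generator (compatible_generators p i G F) u
       \<le> greatest_generator (compatible_generators p i G' F') u"
proof -
  note pair = comonotone_pair_dist_fun[OF assms(1,3)] comonotone_pair_dist_fun[OF assms(2,3)]
  have "\<exists>f\<in>compatible_generators p i G F. \<exists>f'\<in>compatible_generators p i G' F'.
     (\<forall>g\<in>compatible_generators p i G F. \<forall>u\<in>{0..1}. f u \<le> g u) \<and>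
     (\<forall>g\<in>compatible_generators p i G' F'. \<forall>u\<in>{0..1}. g u \<le> f' u) \<and>
     (\<forall>u\<in>{0..1}. f u \<le> f' u)"
  proof (cases "i \<le> p")
    case True
    have G': "G x = F x * Z x" "G' x = F' x * Z x" for x
      using G True by (simp_all add: shock_margin_def)
    show ?thesis
      unfolding Bex_def compatible_max_iff[OF True G'(1)] compatible_max_iff[OF True G'(2)] Ball_def
      using lower_envelope_interpolant[OF pair(1)] upper_envelope_interpolant[OF pair(3)]
        interpolant_between_envelopes(1)[OF pair(1)] interpolant_between_envelopes(2)[OF pair(3)]
        lower_envelope_le_upper_envelope[OF pair(1,3)] le_funD[OF assms(4)]
      by blast
  next
    case False
    then have i: "p < i" by simp
    have G': "1 - G x = (1 - F x) * (1 - Z x)" "1 - G' x = (1 - F' x) * (1 - Z x)" for x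
      using G False by (simp_all add: shock_margin_def)
    let ?f = "reflect (upper_envelope (\<lambda>x. 1 - F x) (\<lambda>x. 1 - Z x))"
    let ?f' = "reflect (lower_envelope (\<lambda>x. 1 - F' x) (\<lambda>x. 1 - Z x))"
    have "?f u \<le> g u" if "g \<in> compatible_generators p i G F" "u \<in> {0..1}" for g u
      using interpolant_between_envelopes(2)[OF pair(2), of "reflect g" "1 - u"] that
      unfolding compatible_min_iff[OF i G'(1)] by (simp add: reflect_def)
    moreover have "g u \<le> ?f' u" if "g \<in> compatible_generators p i G' F'" "u \<in> {0..1}" for g u
      using interpolant_between_envelopes(1)[OF pair(4), of "reflect g" "1 - u"] that
      unfolding compatible_min_iff[OF i G'(2)] by (simp add: reflect_def)
    moreover have "?f u \<le> ?f' u" if "u \<in> {0..1}" for u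
      using lower_envelope_le_upper_envelope[OF pair(4,2), of "1 - u"] that le_funD[OF assms(4)]
      by (simp add: reflect_def)
    moreover have "?f \<in> compatible_generators p i G F" "?f' \<in> compatible_generators p i G' F'"
      using upper_envelope_interpolant[OF pair(2)] lower_envelope_interpolant[OF pair(4)]
      unfolding compatible_min_iff[OF i G'(1)] compatible_min_iff[OF i G'(2)] by simp_all
    ultimately show ?thesis by blast
  qed
  then obtain f f' where f: "f \<in> compatible_generators p i G F"
      "\<And>g u. g \<in> compatible_generators p i G F \<Longrightarrow> u \<in> {0..1} \<Longrightarrow> f u \<le> g u"
    and f': "f' \<in> compatible_generators p i G' F'"
      "\<And>g u. g \<in> compatible_generators p i G' F' \<Longrightarrow> u \<in> {0..1} \<Longrightarrow> g u \<le> f' u"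
    and ff': "\<And>u. u \<in> {0..1} \<Longrightarrow> f u \<le> f' u"
    by blast
  show "least_generator (compatible_generators p i G F) \<in> compatible_generators p i G F"
    by (rule least_generatorI[where f = f]) (use f in auto)
  show "greatest_generator (compatible_generators p i G' F') \<in> compatible_generators p i G' F'"
    by (rule greatest_generatorI[where f = f']) (use f' in auto)
  show "least_generator (compatible_generators p i G F) u
       \<le> greatest_generator (compatible_generators p i G' F') u" if "u \<in> {0..1}"
    using least_generatorI(2)[where f = f and u = u, OF f(1) _ that] f(2)
      greatest_generatorI(2)[where f = f' and u = u, OF f'(1) _ that] f'(2) ff'[OF that]
    by force
qed

lemma compatible_generators_interpolate:
  assumes "f \<in> compatible_generators p i G F"
  shows "f 0 = 0" "f 1 = 1" "nondegenerate p i (G x) \<Longrightarrow> f (G x) = F x"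
  using assms by (auto simp: compatible_generators_def generating_def nondegenerate_def)

section \<open>The constructed generators\<close>

lemma at_left_ereal_neq_bot:
  fixes x0 :: ereal
  assumes "x < x0"
  shows "at_left x0 \<noteq> bot"
  using eventually_at_left[OF assms, of "\<lambda>_. False"]
  by (auto simp: trivial_limit_def) (meson dense order_less_trans)

lemma at_right_ereal_neq_bot:
  fixes x0 :: ereal
  assumes "x0 < x"
  shows "at_right x0 \<noteq> bot"
  using eventually_at_right[OF assms, of "\<lambda>_. False"]
  by (auto simp: trivial_limit_def) (meson dense order_less_trans)

text \<open>A value of \<open>Lim\<close> carries information only once the limit is known to exist. For a monotone function it
does: it is the supremum of the values on the left, or the infimum of those on the right.\<close>

lemma tendsto_left_lim:
  assumes "mono F" "x < x0"
  shows "(F \<longlongrightarrow> left_lim F x0) (at_left x0)"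
proof -
  let ?s = "SUP y\<in>{..<x0}. F y"
  have bdd: "bdd_above (F ` {..<x0})"
    using assms(1) by (auto intro!: bdd_aboveI[of _ "F x0"] simp: mono_def less_imp_le)
  have "(F \<longlongrightarrow> ?s) (at_left x0)"
  proof (rule order_tendstoI)
    fix a assume "a < ?s"
    then obtain y where y: "y < x0" "a < F y"
      using less_cSUP_iff[OF _ bdd, of a] assms(2) by auto
    show "eventually (\<lambda>x. a < F x) (at_left x0)"
      unfolding eventually_at_left[OF y(1)] using y assms(1)
      by (intro exI[of _ y]) (auto simp: mono_def intro: less_le_trans less_imp_le)
  next
    fix a assume a: "?s < a"
    have "F y < a" if "y < x0" for y
      using cSUP_upper[OF _ bdd, of y] that a by auto
    then show "eventually (\<lambda>x. F x < a) (at_left x0)"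
      unfolding eventually_at_left[OF assms(2)] using assms(2) by auto
  qed
  then have "left_lim F x0 = ?s"
    using tendsto_Lim[OF at_left_ereal_neq_bot[OF assms(2)]] assms(2) by (auto simp: left_lim_def)
  then show ?thesis
    using \<open>(F \<longlongrightarrow> ?s) (at_left x0)\<close> by simp
qed

lemma tendsto_right_lim:
  assumes "mono F" "x0 < x"
  shows "(F \<longlongrightarrow> right_lim F x0) (at_right x0)"
proof -
  let ?s = "INF y\<in>{x0<..}. F y"
  have bdd: "bdd_below (F ` {x0<..})"
    using assms(1) by (auto intro!: bdd_belowI[of _ "F x0"] simp: mono_def less_imp_le)
  have "(F \<longlongrightarrow> ?s) (at_right x0)"
  proof (rule order_tendstoI)
    fix a assume "?s < a"
    then obtain y where y: "x0 < y" "F y < a"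
      using cINF_less_iff[OF _ bdd, of a] assms(2) by auto
    show "eventually (\<lambda>x. F x < a) (at_right x0)"
      unfolding eventually_at_right[OF y(1)] using y assms(1)
      by (intro exI[of _ y]) (auto simp: mono_def intro: le_less_trans less_imp_le)
  next
    fix a assume a: "a < ?s"
    have "a < F y" if "x0 < y" for y
      using cINF_lower[OF bdd, of y] that a by auto
    then show "eventually (\<lambda>x. a < F x) (at_right x0)"
      unfolding eventually_at_right[OF assms(2)] using assms(2) by auto
  qed
  then have "right_lim F x0 = ?s"
    using tendsto_Lim[OF at_right_ereal_neq_bot[OF assms(2)]] assms(2) by (auto simp: right_lim_def)
  then show ?thesis
    using \<open>(F \<longlongrightarrow> ?s) (at_right x0)\<close> by simp
qed

lemma le_left_lim:
  assumes "mono F" "x < x0"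
  shows "F x \<le> left_lim F x0"
proof (rule tendsto_lowerbound[OF tendsto_left_lim[OF assms] _ at_left_ereal_neq_bot[OF assms(2)]])
  show "eventually (\<lambda>y. F x \<le> F y) (at_left x0)"
    unfolding eventually_at_left[OF assms(2)] using assms by (auto simp: mono_def less_imp_le)
qed

lemma left_lim_le:
  assumes "mono F"
  shows "left_lim F x0 \<le> F x0"
proof (cases "x0 = -\<infinity>")
  case False
  then have "-\<infinity> < x0" by simp
  then show ?thesis
    by (rule_tac tendsto_upperbound[OF tendsto_left_lim[OF assms] _ at_left_ereal_neq_bot])
      (auto simp: eventually_at_left[OF \<open>-\<infinity> < x0\<close>] intro!: exI[of _ "-\<infinity>"] monoD[OF assms])
qed (simp add: left_lim_def)

lemma right_lim_le:
  assumes "mono F" "x0 < x"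
  shows "right_lim F x0 \<le> F x"
proof (rule tendsto_upperbound[OF tendsto_right_lim[OF assms] _ at_right_ereal_neq_bot[OF assms(2)]])
  show "eventually (\<lambda>y. F y \<le> F x) (at_right x0)"
    unfolding eventually_at_right[OF assms(2)] using assms by (auto simp: mono_def less_imp_le)
qed

lemma le_right_lim:
  assumes "mono F"
  shows "F x0 \<le> right_lim F x0"
proof (cases "x0 = \<infinity>")
  case False
  then have "x0 < \<infinity>" by simp
  then show ?thesis
    by (rule_tac tendsto_lowerbound[OF tendsto_right_lim[OF assms] _ at_right_ereal_neq_bot])
      (auto simp: eventually_at_right[OF \<open>x0 < \<infinity>\<close>] intro!: exI[of _ "\<infinity>"] monoD[OF assms])
qed (simp add: right_lim_def)

text \<open>If \<open>x < x0\<close> but \<open>G x\<close> is not below the left limit of \<open>G\<close> at \<open>x0\<close>, then \<open>G\<close> is constant from \<open>x\<close> up to \<open>x0\<close>. In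
the construction of a generator this is the situation where the chosen admissible point \<open>x0\<close> is not
\<open>x\<close> itself.\<close>

lemma left_lim_eq_if_flat:
  assumes "mono F" "mono G" "x < x0" "left_lim G x0 \<le> G x"
    and flat: "\<And>y. x \<le> y \<Longrightarrow> G y = G x \<Longrightarrow> F y = F x"
  shows "left_lim F x0 = F x"
proof -
  have "F y = F x" if "x < y" "y < x0" for y
    using le_left_lim[OF assms(2) that(2)] monoD[OF assms(2) less_imp_le[OF that(1)]] assms(4) that
    by (intro flat[of y]) (simp, linarith)
  then have "eventually (\<lambda>y. F y = F x) (at_left x0)"
    unfolding eventually_at_left[OF assms(3)] using assms(3) by auto
  then have "(F \<longlongrightarrow> F x) (at_left x0)"
    by (rule tendsto_eventually)
  then show ?thesis
    using tendsto_unique[OF at_left_ereal_neq_bot[OF assms(3)]] tendsto_left_lim[OF assms(1,3)]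
    by blast
qed

lemma right_lim_eq_if_flat:
  assumes "mono F" "mono G" "x0 < x" "G x \<le> right_lim G x0"
    and flat: "\<And>y. y \<le> x \<Longrightarrow> G y = G x \<Longrightarrow> F y = F x"
  shows "right_lim F x0 = F x"
proof -
  have "F y = F x" if "x0 < y" "y < x" for y
    using right_lim_le[OF assms(2) that(1)] monoD[OF assms(2) less_imp_le[OF that(2)]] assms(4) that
    by (intro flat[of y]) (simp, linarith)
  then have "eventually (\<lambda>y. F y = F x) (at_right x0)"
    unfolding eventually_at_right[OF assms(3)] using assms(3) by auto
  then have "(F \<longlongrightarrow> F x) (at_right x0)"
    by (rule tendsto_eventually)
  then show ?thesis
    using tendsto_unique[OF at_right_ereal_neq_bot[OF assms(3)]] tendsto_right_lim[OF assms(1,3)]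
    by blast
qed

text \<open>The reason why \<open>F\<close> is constant wherever the positive product \<open>G\<close> of \<open>F\<close> and \<open>FZ\<close> is.\<close>

lemma mult_flat:
  fixes a b c d :: real
  assumes "0 \<le> a" "a \<le> b" "0 \<le> c" "c \<le> d" "b * d = a * c" "0 < a * c"
  shows "a = b"
proof (rule ccontr)
  assume "a \<noteq> b"
  moreover have "0 < c" using assms by (auto simp: zero_less_mult_iff)
  ultimately have "a * c < b * c" using assms by simp
  also have "\<dots> \<le> b * d" using assms by (intro mult_left_mono) auto
  finally show False using assms by simp
qed

text \<open>The value \<open>G x\<close> may be assigned through an admissible point \<open>x0\<close> other than \<open>x\<close>. Then \<open>G\<close>, hence also \<open>F\<close>,
is constant between \<open>x\<close> and \<open>x0\<close>, so the one-sided limit of \<open>F\<close> at \<open>x0\<close> that the construction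
prescribes is \<open>F x\<close>. For \<open>x0 = x\<close> the middle branch divides \<open>G x\<close> by \<open>Z x\<close>.\<close>

lemma constructed_max_interpolates:
  assumes dist: "dist_fun F" "dist_fun Z" and G: "\<And>x. G x = F x * Z x"
    and f: "constructed_max F Z G f" and pos: "0 < G x"
  shows "f (G x) = F x"
proof -
  have range: "0 \<le> F y" "F y \<le> 1" "0 \<le> Z y" "Z y \<le> 1" for y
    using dist by (auto simp: dist_fun_def Pi_iff)
  have mono: "mono F" "mono Z"
    using dist by (auto simp: dist_fun_def)
  have monoG: "mono G"
    unfolding G by (intro monoI mult_mono monoD[OF mono(1)] monoD[OF mono(2)]) (auto simp: range)
  have le: "G x \<le> F x"
    unfolding G using range by (simp add: mult_left_le)
  show ?thesis
  proof (cases "G x = 1")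
    case True
    then show ?thesis
      using le range(2)[of x] f by (simp add: constructed_max_def)
  next
    case False
    then have "G x \<in> {0<..<1}"
      using pos le range(2)[of x] by simp
    then obtain x0 where x0: "left_lim G x0 \<le> G x" "G x \<le> right_lim G x0"
      and low: "G x \<le> left_lim F x0 * Z x0 \<Longrightarrow> f (G x) = left_lim F x0"
      and mid: "left_lim F x0 * Z x0 \<le> G x \<Longrightarrow> G x \<le> right_lim F x0 * Z x0 \<Longrightarrow>
          f (G x) = G x / Z x0"
      and high: "right_lim F x0 * Z x0 \<le> G x \<Longrightarrow> f (G x) = right_lim F x0"
      using f unfolding constructed_max_def Let_def by blast
    consider "x = x0" | "x < x0" | "x0 < x" by (meson linorder_less_linear)
    then show ?thesis
    proof cases
      case 1
      have "left_lim F x0 * Z x0 \<le> F x0 * Z x0" "F x0 * Z x0 \<le> right_lim F x0 * Z x0"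
        using left_lim_le[OF mono(1)] le_right_lim[OF mono(1)] range by (auto intro: mult_right_mono)
      then have "f (G x) = G x / Z x0"
        by (intro mid) (simp_all add: 1 G)
      then show ?thesis
        using pos by (auto simp: 1 G)
    next
      case 2
      have "left_lim F x0 = F x"
      proof (rule left_lim_eq_if_flat[OF mono(1) monoG 2 x0(1)])
        fix y assume "x \<le> y" "G y = G x"
        then show "F y = F x"
          using mult_flat[of "F x" "F y" "Z x" "Z y"] pos range
            monoD[OF mono(1), of x y] monoD[OF mono(2), of x y] by (simp add: G)
      qed
      moreover have "G x \<le> F x * Z x0"
        unfolding G using 2 range monoD[OF mono(2), of x x0] by (intro mult_left_mono) auto
      ultimately show ?thesis
        using low by simp
    next
      case 3
      have "right_lim F x0 = F x"
      proof (rule right_lim_eq_if_flat[OF mono(1) monoG 3 x0(2)])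
        fix y assume "y \<le> x" "G y = G x"
        then show "F y = F x"
          using mult_flat[of "F y" "F x" "Z y" "Z x"] pos range
            monoD[OF mono(1), of y x] monoD[OF mono(2), of y x] by (simp add: G)
      qed
      moreover have "F x * Z x0 \<le> G x"
        unfolding G using 3 range monoD[OF mono(2), of x0 x] by (intro mult_left_mono) auto
      ultimately show ?thesis
        using high by simp
    qed
  qed
qed

text \<open>The same case distinction as for \<open>constructed_max\<close>, applied to the positive product
\<open>1 - G x = (1 - F x) * (1 - Z x)\<close>.\<close>

lemma constructed_min_interpolates:
  assumes dist: "dist_fun F" "dist_fun Z" and G: "\<And>x. 1 - G x = (1 - F x) * (1 - Z x)"
    and f: "constructed_min F Z G f" and less: "G x < 1"
  shows "f (G x) = F x"
proof -
  have range: "0 \<le> F y" "F y \<le> 1" "0 \<le> Z y" "Z y \<le> 1" for y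
    using dist by (auto simp: dist_fun_def Pi_iff)
  have mono: "mono F" "mono Z"
    using dist by (auto simp: dist_fun_def)
  have shift: "a + z - a * z = 1 - (1 - a) * (1 - z)" for a z :: real
    by (simp add: algebra_simps)
  have G': "G y = 1 - (1 - F y) * (1 - Z y)" for y
    using G[of y] by simp
  have pos: "0 < (1 - F x) * (1 - Z x)"
    using less G[of x] by simp
  have monoG: "mono G"
  proof (rule monoI)
    fix y y' :: ereal assume "y \<le> y'"
    then have "(1 - F y') * (1 - Z y') \<le> (1 - F y) * (1 - Z y)"
      using mono range by (intro mult_mono) (auto simp: mono_def)
    then show "G y \<le> G y'" by (simp add: G')
  qed
  have "(1 - F x) * (1 - Z x) \<le> 1 - F x"
    using range by (simp add: mult_left_le)
  then have le: "F x \<le> G x" by (simp add: G')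
  show ?thesis
  proof (cases "G x = 0")
    case True
    then show ?thesis
      using le range(1)[of x] f by (simp add: constructed_min_def)
  next
    case False
    then have "G x \<in> {0<..<1}"
      using less le range(1)[of x] by simp
    then obtain x0 where x0: "left_lim G x0 \<le> G x" "G x \<le> right_lim G x0"
      and low: "G x \<le> 1 - (1 - left_lim F x0) * (1 - Z x0) \<Longrightarrow> f (G x) = left_lim F x0"
      and mid: "1 - (1 - left_lim F x0) * (1 - Z x0) \<le> G x \<Longrightarrow>
          G x \<le> 1 - (1 - right_lim F x0) * (1 - Z x0) \<Longrightarrow>
          f (G x) = (G x - Z x0) / (1 - Z x0)"
      and high: "1 - (1 - right_lim F x0) * (1 - Z x0) \<le> G x \<Longrightarrow> f (G x) = right_lim F x0"
      using f unfolding constructed_min_def Let_def shift by blast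
    consider "x = x0" | "x < x0" | "x0 < x" by (meson linorder_less_linear)
    then show ?thesis
    proof cases
      case 1
      have "(1 - F x0) * (1 - Z x0) \<le> (1 - left_lim F x0) * (1 - Z x0)"
        "(1 - right_lim F x0) * (1 - Z x0) \<le> (1 - F x0) * (1 - Z x0)"
        using left_lim_le[OF mono(1), of x0] le_right_lim[OF mono(1), of x0] range
        by (auto intro: mult_right_mono)
      then have "f (G x) = (G x - Z x0) / (1 - Z x0)"
        by (intro mid) (simp_all add: 1 G')
      also have "G x - Z x0 = F x * (1 - Z x0)"
        by (simp add: 1 G' algebra_simps)
      also have "\<dots> / (1 - Z x0) = F x"
        using pos by (auto simp: 1)
      finally show ?thesis .
    next
      case 2
      have "left_lim F x0 = F x"
      proof (rule left_lim_eq_if_flat[OF mono(1) monoG 2 x0(1)])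
        fix y assume "x \<le> y" "G y = G x"
        then show "F y = F x"
          using mult_flat[of "1 - F y" "1 - F x" "1 - Z y" "1 - Z x"] pos range
            monoD[OF mono(1), of x y] monoD[OF mono(2), of x y] by (simp add: G')
      qed
      moreover have "(1 - F x) * (1 - Z x0) \<le> (1 - F x) * (1 - Z x)"
        using 2 range monoD[OF mono(2), of x x0] by (intro mult_left_mono) auto
      ultimately show ?thesis
        using low by (simp add: G')
    next
      case 3
      have "right_lim F x0 = F x"
      proof (rule right_lim_eq_if_flat[OF mono(1) monoG 3 x0(2)])
        fix y assume "y \<le> x" "G y = G x"
        then show "F y = F x"
          using mult_flat[of "1 - F x" "1 - F y" "1 - Z x" "1 - Z y"] pos range
            monoD[OF mono(1), of y x] monoD[OF mono(2), of y x] by (simp add: G')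
      qed
      moreover have "(1 - F x) * (1 - Z x) \<le> (1 - F x) * (1 - Z x0)"
        using 3 range monoD[OF mono(2), of x0 x] by (intro mult_left_mono) auto
      ultimately show ?thesis
        using high by (simp add: G')
    qed
  qed
qed

lemma constructed_interpolates:
  assumes "dist_fun F" "dist_fun Z" "\<And>x. G x = shock_margin p i (F x) (Z x)"
    and "constructed p i F Z G f" "nondegenerate p i (G x)"
  shows "f (G x) = F x"
  using assms constructed_max_interpolates[of F Z G f x] constructed_min_interpolates[of F Z G f x]
  by (cases "i \<le> p") (simp_all add: shock_margin_def constructed_def nondegenerate_def)

lemma constructed_endpoints:
  assumes "constructed p i F Z G f"
  shows "f 0 = 0" "f 1 = 1"
  using assms by (auto simp: constructed_def constructed_max_def constructed_min_def split: if_splits)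

section \<open>The bounds for the shock model\<close>

theorem theorem11:
  fixes n p :: nat
    and Fl Fu F :: "nat \<Rightarrow> ereal \<Rightarrow> real" and FZ :: "ereal \<Rightarrow> real"
    and \<Omega> :: "'a set" and M :: "'a set set" and P :: "'a set \<Rightarrow> real"
    and X :: "nat \<Rightarrow> 'a \<Rightarrow> ereal" and Z :: "'a \<Rightarrow> ereal"
    and G Gl Gu :: "nat \<Rightarrow> ereal \<Rightarrow> real" and H Hl Hu :: "(nat \<Rightarrow> ereal) \<Rightarrow> real"
    and \<phi> \<phi>l \<phi>u :: "nat \<Rightarrow> real \<Rightarrow> real"
  assumes "1 \<le> p" and "p < n"
    and "\<And>i. i \<in> {1..n} \<Longrightarrow> dist_fun (Fl i) \<and> dist_fun (Fu i) \<and> Fl i \<le> Fu i"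
    and "dist_fun FZ"
    and "\<And>i. i \<in> {1..n} \<Longrightarrow> F i \<in> dist_box (Fl i) (Fu i)"
    and "shock_model n \<Omega> M P X Z F FZ"
    and "G = shock_G p \<Omega> P X Z"
    and "Gl = lower_G n p Fl Fu FZ"
    and "Gu = upper_G n p Fl Fu FZ"
    and "H = shock_H n p \<Omega> P X Z"
    and "Hl = lower_H n p Fl Fu FZ"
    and "Hu = upper_H n p Fl Fu FZ"
    and "\<And>i. i \<in> {1..n} \<Longrightarrow> constructed p i (F i) FZ (G i) (\<phi> i)"
    and "\<And>i. i \<in> {1..n} \<Longrightarrow> \<phi>l i = least_generator (compatible_generators p i (Gl i) (Fl i))"
    and "\<And>i. i \<in> {1..n} \<Longrightarrow> \<phi>u i = greatest_generator (compatible_generators p i (Gu i) (Fu i))"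
  shows
    "(\<comment> \<open>(i)\<close> \<forall>i\<in>{1..n}. \<forall>u\<in>{0..1}. \<phi>l i u \<le> \<phi>u i u) \<and>
     (\<comment> \<open>(ii)\<close> (\<forall>i\<in>{1..p}. \<forall>x.
          G i x = F i x * FZ x \<and> Gl i x = Fl i x * FZ x \<and> Gu i x = Fu i x * FZ x) \<and>
        (\<forall>j\<in>{p+1..n}. \<forall>x.
          1 - G j x = (1 - F j x) * (1 - FZ x) \<and>
          1 - Gl j x = (1 - Fl j x) * (1 - FZ x) \<and>
          1 - Gu j x = (1 - Fu j x) * (1 - FZ x))) \<and>
     (\<comment> \<open>(iii)\<close> \<forall>i\<in>{1..n}. Gl i \<le> G i \<and> G i \<le> Gu i) \<and>
     (\<comment> \<open>(iv)\<close> (\<forall>i\<in>{1..p}. \<forall>x.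
          (Gl i x > 0 \<longrightarrow> \<phi>l i (Gl i x) = Fl i x) \<and>
          (Gu i x > 0 \<longrightarrow> \<phi>u i (Gu i x) = Fu i x)) \<and>
        (\<forall>j\<in>{p+1..n}. \<forall>x.
          (Gl j x < 1 \<longrightarrow> \<phi>l j (Gl j x) = Fl j x) \<and>
          (Gu j x < 1 \<longrightarrow> \<phi>u j (Gu j x) = Fu j x))) \<and>
     (\<comment> \<open>(v)\<close> (\<forall>i\<in>{1..p}. \<forall>x.
          (G i x > 0 \<longrightarrow> dagger p i (\<phi> i) (G i x) = FZ x) \<and>
          (Gu i x > 0 \<longrightarrow> dagger p i (\<phi>u i) (Gu i x) = FZ x) \<and>
          (Gl i x > 0 \<longrightarrow> dagger p i (\<phi>l i) (Gl i x) = FZ x)) \<and>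
        (\<forall>j\<in>{p+1..n}. \<forall>x.
          (G j x < 1 \<longrightarrow> dagger p j (\<phi> j) (G j x) = FZ x) \<and>
          (Gu j x < 1 \<longrightarrow> dagger p j (\<phi>u j) (Gu j x) = FZ x) \<and>
          (Gl j x < 1 \<longrightarrow> dagger p j (\<phi>l j) (Gl j x) = FZ x))) \<and>
     (\<comment> \<open>(vi)\<close> \<forall>x. H x = C_MM n p \<phi> (\<lambda>i. G i (x i))) \<and>
     (\<comment> \<open>(vii)\<close> \<forall>x.
        C_MM n p \<phi>l (\<lambda>i. Gl i (x i)) \<le> C_MM n p \<phi> (\<lambda>i. G i (x i)) \<and>
        C_MM n p \<phi> (\<lambda>i. G i (x i)) \<le> C_MM n p \<phi>u (\<lambda>i. Gu i (x i))) \<and>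
     (\<comment> \<open>(viii)\<close> \<forall>x.
        Hl x \<in> H_values n p Fl Fu FZ x \<and> Hl x = C_MM n p \<phi>l (\<lambda>i. Gl i (x i)) \<and>
        Hu x \<in> H_values n p Fl Fu FZ x \<and> Hu x = C_MM n p \<phi>u (\<lambda>i. Gu i (x i)))"
proof -
  note p = assms(1,2) and bounds = assms(3) and Z = assms(4)
  have dists: "dist_fun (Fl i)" "dist_fun (F i)" "dist_fun (Fu i)" "Fl i \<le> F i" "F i \<le> Fu i"
    if "i \<in> {1..n}" for i
    using bounds[OF that] assms(5)[OF that] by (auto simp: dist_box_def)
  interpret shock_model_space n p \<Omega> M P X Z F FZ
    using assms(6) dists Z by unfold_locales
  have G: "G i x = shock_margin p i (F i x) (FZ x)"
    and Gl: "Gl i x = shock_margin p i (Fl i x) (FZ x)"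
    and Gu: "Gu i x = shock_margin p i (Fu i x) (FZ x)" if "i \<in> {1..n}" for i x
    using that assms(7-9) shock_G_eq extremal_G[OF bounds Z] by simp_all
  have gen: "\<phi>l i \<in> compatible_generators p i (Gl i) (Fl i)"
      "\<phi>u i \<in> compatible_generators p i (Gu i) (Fu i)"
      "u \<in> {0..1} \<Longrightarrow> \<phi>l i u \<le> \<phi>u i u" if i: "i \<in> {1..n}" for i u
  proof -
    have "Fl i \<le> Fu i" using bounds[OF i] by simp
    note extremal = extremal_generators[OF dists(1,3)[OF i] Z this Gl[OF i] Gu[OF i]]
    show "\<phi>l i \<in> compatible_generators p i (Gl i) (Fl i)"
      "\<phi>u i \<in> compatible_generators p i (Gu i) (Fu i)"
      "u \<in> {0..1} \<Longrightarrow> \<phi>l i u \<le> \<phi>u i u"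
      using extremal assms(14,15)[OF i] by simp_all
  qed
  have interp: "nondegenerate p i (G i x) \<Longrightarrow> \<phi> i (G i x) = F i x"
      "nondegenerate p i (Gl i x) \<Longrightarrow> \<phi>l i (Gl i x) = Fl i x"
      "nondegenerate p i (Gu i x) \<Longrightarrow> \<phi>u i (Gu i x) = Fu i x" if i: "i \<in> {1..n}" for i x
    using constructed_interpolates[OF dists(2)[OF i] Z G[OF i] assms(13)[OF i]]
      compatible_generators_interpolate(3)[OF gen(1)[OF i]]
      compatible_generators_interpolate(3)[OF gen(2)[OF i]] by simp_all
  have ends: "\<phi> i 0 = 0 \<and> \<phi> i 1 = 1" "\<phi>l i 0 = 0 \<and> \<phi>l i 1 = 1" "\<phi>u i 0 = 0 \<and> \<phi>u i 1 = 1"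
    if i: "i \<in> {1..n}" for i
    using constructed_endpoints[OF assms(13)[OF i]]
      compatible_generators_interpolate(1,2)[OF gen(1)[OF i]]
      compatible_generators_interpolate(1,2)[OF gen(2)[OF i]] by simp_all
  have dag: "nondegenerate p i (G i x) \<Longrightarrow> dagger p i (\<phi> i) (G i x) = FZ x"
      "nondegenerate p i (Gl i x) \<Longrightarrow> dagger p i (\<phi>l i) (Gl i x) = FZ x"
      "nondegenerate p i (Gu i x) \<Longrightarrow> dagger p i (\<phi>u i) (Gu i x) = FZ x" if i: "i \<in> {1..n}" for i x
    using dagger_shock_margin[of p i _ "FZ x"] interp[OF i, of x] G[OF i] Gl[OF i] Gu[OF i] by simp_all
  have H: "H x = C_MM n p \<phi> (\<lambda>i. G i (x i))" for x
    using shock_H_eq_C_MM[OF p G ends(1) interp(1)] assms(10) by simp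
  have formula: "C_MM n p \<phi> (\<lambda>i. G i (x i)) =
        shock_formula {1..p} {p+1..n} (\<lambda>i. F i (x i)) (\<lambda>i. FZ (x i))"
      "C_MM n p \<phi>l (\<lambda>i. Gl i (x i)) =
        shock_formula {1..p} {p+1..n} (\<lambda>i. Fl i (x i)) (\<lambda>i. FZ (x i))"
      "C_MM n p \<phi>u (\<lambda>i. Gu i (x i)) =
        shock_formula {1..p} {p+1..n} (\<lambda>i. Fu i (x i)) (\<lambda>i. FZ (x i))" for x
    using shock_formula_eq_C_MM[OF p dists(2) Z G ends(1) interp(1)]
      shock_formula_eq_C_MM[OF p dists(1) Z Gl ends(2) interp(2)]
      shock_formula_eq_C_MM[OF p dists(3) Z Gu ends(3) interp(3)] by simp_all
  note extremal = extremal_H[where Fl = Fl and Fu = Fu, OF p bounds Z]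
  have Hl: "Hl x \<in> H_values n p Fl Fu FZ x" "Hl x = C_MM n p \<phi>l (\<lambda>i. Gl i (x i))"
    and Hu: "Hu x \<in> H_values n p Fl Fu FZ x" "Hu x = C_MM n p \<phi>u (\<lambda>i. Gu i (x i))" for x
    using extremal[of x] assms(11,12) by (simp_all add: formula)
  have sandwich: "C_MM n p \<phi>l (\<lambda>i. Gl i (x i)) \<le> C_MM n p \<phi> (\<lambda>i. G i (x i))"
    "C_MM n p \<phi> (\<lambda>i. G i (x i)) \<le> C_MM n p \<phi>u (\<lambda>i. Gu i (x i))" for x
  proof -
    have le: "0 \<le> Fl i (x i) \<and> 0 \<le> F i (x i) \<and> Fl i (x i) \<le> F i (x i) \<and> F i (x i) \<le> Fu i (x i)"
      if "i \<in> {1..p} \<union> {p+1..n}" for i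
      using dists[of i] that p by (auto simp: dist_fun_def le_fun_def Pi_iff)
    show "C_MM n p \<phi>l (\<lambda>i. Gl i (x i)) \<le> C_MM n p \<phi> (\<lambda>i. G i (x i))"
      "C_MM n p \<phi> (\<lambda>i. G i (x i)) \<le> C_MM n p \<phi>u (\<lambda>i. Gu i (x i))"
      unfolding formula by (rule shock_formula_mono, drule le, simp)+
  qed
  have T: "i \<in> {1..n}" "i \<le> p" if "i \<in> {1..p}" for i using that p by auto
  have S: "j \<in> {1..n}" "\<not> j \<le> p" if "j \<in> {p+1..n}" for j using that p by auto
  have linkT: "G i x = F i x * FZ x \<and> Gl i x = Fl i x * FZ x \<and> Gu i x = Fu i x * FZ x"
    if i: "i \<in> {1..p}" for i x
    unfolding G[OF T(1)[OF i]] Gl[OF T(1)[OF i]] Gu[OF T(1)[OF i]]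
    using T(2)[OF i] by (simp add: shock_margin_def)
  have linkS: "1 - G j x = (1 - F j x) * (1 - FZ x) \<and>
      1 - Gl j x = (1 - Fl j x) * (1 - FZ x) \<and> 1 - Gu j x = (1 - Fu j x) * (1 - FZ x)"
    if j: "j \<in> {p+1..n}" for j x
    unfolding G[OF S(1)[OF j]] Gl[OF S(1)[OF j]] Gu[OF S(1)[OF j]]
    using S(2)[OF j] by (simp add: shock_margin_def)
  have rangeZ: "FZ x \<in> {0..1}" for x
    using Z by (auto simp: dist_fun_def)
  have order: "\<forall>i\<in>{1..n}. Gl i \<le> G i \<and> G i \<le> Gu i"
  proof (intro ballI conjI le_funI)
    fix i x assume i: "i \<in> {1..n}"
    show "Gl i x \<le> G i x" "G i x \<le> Gu i x"
      unfolding G[OF i] Gl[OF i] Gu[OF i]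
      using dists(4,5)[OF i] rangeZ by (auto intro!: shock_margin_mono simp: le_fun_def)
  qed
  have nondegT: "nondegenerate p i u" if "i \<in> {1..p}" "0 < u" for i u
    using T(2)[OF that(1)] that(2) by (simp add: nondegenerate_def)
  have nondegS: "nondegenerate p j u" if "j \<in> {p+1..n}" "u < 1" for j u
    using S(2)[OF that(1)] that(2) by (simp add: nondegenerate_def)
  show ?thesis
    apply (intro conjI)
    subgoal using gen(3) by blast
    subgoal by (intro ballI allI linkT)
    subgoal by (intro ballI allI linkS)
    subgoal by (rule order)
    subgoal by (intro ballI allI conjI impI interp(2,3) nondegT T(1))
    subgoal by (intro ballI allI conjI impI interp(2,3) nondegS S(1))
    subgoal by (intro ballI allI conjI impI dag nondegT T(1))
    subgoal by (intro ballI allI conjI impI dag nondegS S(1))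
    subgoal by (intro allI H)
    subgoal by (intro allI conjI sandwich)
    subgoal by (intro allI conjI Hl Hu)
    done
qed

end
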